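(* Let $K$ be a field with $\operatorname{char} K\neq 2$. Fix any real number $r\ge 1$. There exists a three-generated Jordan superalgebra $J$ over $K$ with the following properties. (i) $\operatorname{GKdim} J=\underline{\operatorname{GKdim}}\, J=r$. (ii) $J$ is graded by degree in the generators, $J=\bigoplus_{n=0}^\infty J_n$, where $J_{3n}=0$ for all $n\ge 1$. (iii) Its ideal without unit $J^0$ is solvable of length $3$.
   Context: A Jordan superalgebra ($\operatorname{char}K\ne2$) is a $\mathbb Z_2$-graded algebra $J=J_{\bar 0}\oplus J_{\bar 1}$ satisfying, for homogeneous elements, $ab=(-1)^{|a||b|}ba$ and $$(ab)(cd)+(-1)^{|b||c|}(ac)(bd)+(-1)^{(|b|+|c|)|d|}(ad)(bc)=((ab)c)d+(-1)^{|b|(|c|+|d|)+|c||d|}((ad)c)b+(-1)^{|a|(|b|+|c|+|d|)+|c||d|}((bd)c)a.$$ The algebra $J$ here has a unit $1$, which is regarded as the empty monomial (of degree $0$); "three-generated" means generated, as a unital algebra, by three elements. $J$ is graded by degree in a generating set $X$ if $J=\bigoplus_{n\ge 0}J_n$, where $J_n$ is the span of all monomials of length exactly $n$ in $X$ and $J_0=\langle 1\rangle$. The ideal without unit is $J^0=\bigoplus_{n\ge1}J_n$. Solvable of length $3$ refers to the derived series $A\supset A^2\supset (A^2)^2\supset ((A^2)^2)^2=0$, where $A=J^0$ and $B^2$ denotes the span of all products of two elements of $B$. For an algebra $A$ generated by a finite set $X$, let $\gamma_A(X,n)$ be the dimension of the span of all monomials in $X$ of length at most $n$. The upper and lower Gelfand-Kirillov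 dimensions are $\operatorname{GKdim}A=\limsup_{n\to\infty}\frac{\ln\gamma_A(X,n)}{\ln n}$ and $\underline{\operatorname{GKdim}}\,A=\liminf_{n\to\infty}\frac{\ln\gamma_A(X,n)}{\ln n}$; they do not depend on the choice of the finite generating set $X$. *)

theory Defs
  imports
    "HOL-Analysis.Analysis"
    "HOL-Library.Poly_Mapping"
    "HOL-Library.Z2"
begin

text \<open>
  Algebras are unital but not necessarily associative. The underlying vector space is a
  whole type, with scalar multiplication as an explicit parameter.
\<close>

locale unital_algebra = vector_space scale
  for scale :: "'k::field \<Rightarrow> 'v::ab_group_add \<Rightarrow> 'v" +
  fixes mult :: "'v \<Rightarrow> 'v \<Rightarrow> 'v" (infixl \<open>\<odot>\<close> 70)
    and one :: 'v
  assumes linear_mult_left: "Vector_Spaces.linear scale scale (\<lambda>a. a \<odot> b)"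
    and linear_mult_right: "Vector_Spaces.linear scale scale (\<lambda>b. a \<odot> b)"
    and one_mult: "one \<odot> a = a"
    and mult_one: "a \<odot> one = a"
begin

definition unital_subalgebra :: "'v set \<Rightarrow> bool" where
  "unital_subalgebra S \<longleftrightarrow>
     subspace S \<and> one \<in> S \<and> (\<forall>a\<in>S. \<forall>b\<in>S. a \<odot> b \<in> S)"

definition generates :: "'v set \<Rightarrow> bool" where
  "generates X \<longleftrightarrow> unital_subalgebra hull X = UNIV"

text \<open>
  \<open>monomial X n u\<close>: \<open>u\<close> is a monomial of length \<open>n\<close> in \<open>X\<close>, with arbitrary
  bracketing; the unit is the empty monomial, so that length \<open>0\<close> gives \<open>one\<close> only.
\<close>

inductive monomial :: "'v set \<Rightarrow> nat \<Rightarrow> 'v \<Rightarrow> bool" for X where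
  unit: "monomial X 0 one"
| generator: "x \<in> X \<Longrightarrow> monomial X 1 x"
| product: "monomial X m u \<Longrightarrow> monomial X n v \<Longrightarrow> monomial X (m + n) (u \<odot> v)"

definition deg_component :: "'v set \<Rightarrow> nat \<Rightarrow> 'v set" where
  "deg_component X n = span {u. monomial X n u}"

text \<open>The whole space is the internal direct sum of the family \<open>C\<close>.\<close>

definition direct_sum :: "('i \<Rightarrow> 'v set) \<Rightarrow> bool" where
  "direct_sum C \<longleftrightarrow> (\<forall>i. subspace (C i)) \<and>
     (\<forall>v. \<exists>!f. (\<forall>i. f i \<in> C i) \<and> finite {i. f i \<noteq> 0} \<and> v = (\<Sum>i | f i \<noteq> 0. f i))"

definition graded_by_degree :: "'v set \<Rightarrow> bool" where
  "graded_by_degree X \<longleftrightarrow> direct_sum (deg_component X)"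

definition ideal_without_unit :: "'v set \<Rightarrow> 'v set" where
  "ideal_without_unit X = span (\<Union>n\<in>{1..}. deg_component X n)"

definition square :: "'v set \<Rightarrow> 'v set" where
  "square B = span {a \<odot> b | a b. a \<in> B \<and> b \<in> B}"

definition solvable_of_length :: "nat \<Rightarrow> 'v set \<Rightarrow> bool" where
  "solvable_of_length n A \<longleftrightarrow>
     (\<forall>m<n. (square ^^ Suc m) A \<subset> (square ^^ m) A) \<and> (square ^^ n) A = {0}"

text \<open>The growth function and both dimensions are meant for finite \<open>X\<close>.\<close>

definition growth :: "'v set \<Rightarrow> nat \<Rightarrow> nat" where
  "growth X n = dim (span {u. \<exists>m\<le>n. monomial X m u})"

definition upper_GKdim :: "'v set \<Rightarrow> ereal" where
  "upper_GKdim X = limsup (\<lambda>n. ereal (ln (real (growth X n)) / ln (real n)))"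

definition lower_GKdim :: "'v set \<Rightarrow> ereal" where
  "lower_GKdim X = liminf (\<lambda>n. ereal (ln (real (growth X n)) / ln (real n)))"

end

text \<open>Koszul sign \<open>(-1)\<^sup>e\<close> for an exponent in \<open>\<int>/2\<close>, the type \<^typ>\<open>bit\<close>.\<close>

definition ksign :: "bit \<Rightarrow> 'k::field" where
  "ksign e = (if e = 0 then 1 else -1)"

locale superalgebra = unital_algebra scale mult one
  for scale :: "'k::field \<Rightarrow> 'v::ab_group_add \<Rightarrow> 'v"
    and mult :: "'v \<Rightarrow> 'v \<Rightarrow> 'v" (infixl \<open>\<odot>\<close> 70)
    and one :: 'v +
  fixes part :: "bit \<Rightarrow> 'v set"
  assumes direct_sum_part: "direct_sum part"
    and part_mult: "a \<in> part p \<Longrightarrow> b \<in> part q \<Longrightarrow> a \<odot> b \<in> part (p + q)"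

locale jordan_superalgebra = superalgebra scale mult one part
  for scale :: "'k::field \<Rightarrow> 'v::ab_group_add \<Rightarrow> 'v" (infixr \<open>*s\<close> 75)
    and mult :: "'v \<Rightarrow> 'v \<Rightarrow> 'v" (infixl \<open>\<odot>\<close> 70)
    and one :: 'v
    and part :: "bit \<Rightarrow> 'v set" +
  assumes supercommutative:
    "a \<in> part p \<Longrightarrow> b \<in> part q \<Longrightarrow> a \<odot> b = ksign (p * q) *s (b \<odot> a)"
    and jordan_identity:
    "a \<in> part p \<Longrightarrow> b \<in> part q \<Longrightarrow> c \<in> part r \<Longrightarrow> d \<in> part s \<Longrightarrow>
       (a \<odot> b) \<odot> (c \<odot> d)
       + ksign (q * r) *s ((a \<odot> c) \<odot> (b \<odot> d))
       + ksign ((q + r) * s) *s ((a \<odot> d) \<odot> (b \<odot> c))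
       = ((a \<odot> b) \<odot> c) \<odot> d
       + ksign (q * (r + s) + r * s) *s (((a \<odot> d) \<odot> c) \<odot> b)
       + ksign (p * (q + r + s) + r * s) *s (((b \<odot> d) \<odot> c) \<odot> a)"

end

theory Submission
  imports Defs "HOL-Real_Asymp.Real_Asymp" "HOL-Library.Multiset"
begin

text \<open>
  The superalgebra is a double of a Lie algebra. Let \<open>L\<close> be a Lie algebra, regarded as purely
  even, and let \<open>J\<close> have the basis consisting of \<open>1\<close>, an odd element \<open>X\<close>, the elements \<open>v\<close> of
  a basis of \<open>L\<close>, and odd copies \<open>v'\<close> of them. Apart from the unit, the only nonzero products are
  \<open>X v = v X = v'\<close> and \<open>v' w' = [v, w]\<close>. (This is the Kantor double of the Poisson algebra
  \<open>\<langle>1\<rangle> \<oplus> L\<close> in which \<open>L\<close> has zero associative product.) The Jordan identity for \<open>J\<close> comes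
  down to the Jacobi identity, where \<open>X\<close> occupies the third argument and the other
  three are copies; the other cases follow from the antisymmetry of the bracket (lemma \<open>prod_jordan\<close>).

  If \<open>L\<close> is graded and generated by two elements of degree \<open>1\<close>, then \<open>J\<close> is generated by them and
  \<open>X\<close>: multiplication by \<open>X\<close> turns \<open>v\<close> into \<open>v'\<close>, and products of copies are brackets. An element
  \<open>v\<close> of degree \<open>n\<close> is a monomial of length \<open>3 n - 2\<close> in the generators and \<open>v'\<close> one of length
  \<open>3 n - 1\<close>, so positive multiples of \<open>3\<close> do not occur. The ideal without unit is spanned
  by \<open>X\<close>, \<open>L\<close> and \<open>L'\<close>; its square lies in \<open>L + L'\<close>, the next square lies in \<open>L\<close>, and
  \<open>L L = 0\<close>. Hence everything depends on the growth of \<open>L\<close> (theorem \<open>jordan_double\<close>), and the task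
  is to find a Lie algebra with two generators, in which the number of basis elements of
  degree at most \<open>n\<close> is of order \<open>n\<^sup>r\<close>.

  Write \<open>r = m + 1 + \<sigma>\<close> with an integer \<open>m \<ge> 0\<close> and \<open>0 \<le> \<sigma> < 1\<close>. Consider a commutative algebra
  \<open>M\<close> with a derivation \<open>D\<close> that is generated, as a differential algebra, by one element \<open>t\<close>, and
  put \<open>\<tau>\<^sub>i = D\<^sup>i t\<close>. The operators \<open>s = D\<close> and multiplication by \<open>\<tau>\<^sub>i\<close> satisfy
  \<open>[s, \<tau>\<^sub>i] = \<tau>\<^sub>i\<^sub>+\<^sub>1\<close> and \<open>[\<tau>\<^sub>i, \<tau>\<^sub>j] = 0\<close>. In the semidirect product of this Lie algebra of operators
  with the module \<open>M\<close>, let \<open>L\<close> be generated by \<open>s\<close> and \<open>b = \<tau>\<^sub>0 + e\<close>, where \<open>e\<close> is the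
  unit of \<open>M\<close>. Since \<open>s e = 0\<close>, the iterated brackets of \<open>s\<close> with \<open>b\<close> are the \<open>\<tau>\<^sub>i\<close>, and
  \<open>[\<tau>\<^sub>i, b] = \<tau>\<^sub>i e\<close>; so \<open>L\<close> consists of \<open>s\<close>, \<open>b\<close>, the \<open>\<tau>\<^sub>i\<close> with \<open>i \<ge> 1\<close> and the
  ideal of \<open>M\<close> that these generate. The growth of \<open>L\<close> is therefore of the order of that of \<open>M\<close>.

  For \<open>M\<close> take \<open>K[y\<^sub>0, ..., y\<^sub>m\<^sub>-\<^sub>1] \<otimes> (\<langle>1\<rangle> \<oplus> \<langle>t\<^sub>0, t\<^sub>1, ...\<rangle> \<oplus> W)\<close>, where \<open>D\<close> maps each \<open>y\<^sub>j\<close> to the next one,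
  \<open>y\<^sub>m\<^sub>-\<^sub>1\<close> to \<open>t\<^sub>0\<close>, and \<open>t\<^sub>i\<close> to \<open>t\<^sub>i\<^sub>+\<^sub>1\<close>. Identify \<open>t\<^sub>i t\<^sub>j\<close> with the symmetric polynomial
  \<open>x\<^sub>1\<^sup>i x\<^sub>2\<^sup>j + x\<^sub>1\<^sup>j x\<^sub>2\<^sup>i\<close>; then \<open>D\<close> is multiplication by \<open>x\<^sub>1 + x\<^sub>2\<close>. Symmetric polynomials are a free
  module over \<open>K[x\<^sub>1 + x\<^sub>2]\<close> with the powers of \<open>x\<^sub>1 x\<^sub>2\<close> as a basis, so any set of these powers may be
  discarded without losing compatibility with \<open>D\<close>, and \<open>W\<close> retains the exponents from a set \<open>S\<close>
  only. Products of three \<open>t\<^sub>i\<close> are zero. If \<open>S\<close> has about \<open>n\<^sup>\<sigma>\<close> elements up to \<open>n\<close>, then the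
  summand with \<open>W\<close> has growth \<open>n\<^sup>m \<cdot> n \<cdot> n\<^sup>\<sigma>\<close>, while the other summands grow at most like
  \<open>n\<^sup>m\<^sup>+\<^sup>1\<close>. The characteristic enters because \<open>t\<^sub>l\<^sup>2\<close> involves \<open>2 (x\<^sub>1 x\<^sub>2)\<^sup>l\<close>, and \<open>(x\<^sub>1 x\<^sub>2)\<^sup>l\<close> must be
  obtained from it.
\<close>

section \<open>Growth does not depend on the generating set\<close>

context unital_algebra
begin

lemma mult_simps:
  "(a + a') \<odot> b = a \<odot> b + a' \<odot> b" "a \<odot> (b + b') = a \<odot> b + a \<odot> b'"
  "scale c a \<odot> b = scale c (a \<odot> b)" "a \<odot> scale c b = scale c (a \<odot> b)"
  "0 \<odot> b = 0" "a \<odot> 0 = 0"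
proof -
  show "(a + a') \<odot> b = a \<odot> b + a' \<odot> b" "scale c a \<odot> b = scale c (a \<odot> b)" for a a' b c
    using linear_mult_left[of b] by (auto simp: Vector_Spaces.linear_iff)
  show "a \<odot> (b + b') = a \<odot> b + a \<odot> b'" "a \<odot> scale c b = scale c (a \<odot> b)" for a b b' c
    using linear_mult_right[of a] by (auto simp: Vector_Spaces.linear_iff)
  from this(2)[of a 0 0] \<open>scale 0 0 \<odot> b = scale 0 (0 \<odot> b)\<close>
  show "0 \<odot> b = 0" "a \<odot> 0 = 0"
    by simp_all
qed

lemma mult_span_subset:
  assumes "a \<in> span A" "b \<in> span B"
    and "\<And>a b. a \<in> A \<Longrightarrow> b \<in> B \<Longrightarrow> a \<odot> b \<in> span C"
  shows "a \<odot> b \<in> span C"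
proof -
  have right: "a \<odot> b \<in> span C" if "a \<in> A" for a
    using assms(2)
  proof (induction rule: span_induct)
    case base
    show ?case
      by (auto simp: subspace_def mult_simps span_zero intro: span_add span_scale)
  qed (use assms(3) that in blast)
  show ?thesis
    using assms(1)
  proof (induction rule: span_induct)
    case base
    show ?case
      by (auto simp: subspace_def mult_simps span_zero intro: span_add span_scale)
  qed (use right in blast)
qed

definition monomials_upto :: "'v set \<Rightarrow> nat \<Rightarrow> 'v set" where
  "monomials_upto X n = {u. \<exists>m\<le>n. monomial X m u}"

lemma growth_eq: "growth X n = dim (monomials_upto X n)"
  by (simp add: growth_def monomials_upto_def)

lemma span_monomials_upto_mono:
  "m \<le> n \<Longrightarrow> span (monomials_upto X m) \<subseteq> span (monomials_upto X n)"
  by (rule span_mono) (auto simp: monomials_upto_def intro: order_trans)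

text \<open>Lengths add under multiplication; this makes the spans a filtration of the algebra.\<close>

lemma mult_span_monomials_upto:
  assumes "a \<in> span (monomials_upto X m)" "b \<in> span (monomials_upto X n)"
  shows "a \<odot> b \<in> span (monomials_upto X (m + n))"
  using assms
proof (rule mult_span_subset)
  fix a b assume "a \<in> monomials_upto X m" "b \<in> monomials_upto X n"
  then obtain i j where "i \<le> m" "monomial X i a" "j \<le> n" "monomial X j b"
    by (auto simp: monomials_upto_def)
  then have "monomial X (i + j) (a \<odot> b)" "i + j \<le> m + n"
    by (auto intro: monomial.product)
  then show "a \<odot> b \<in> span (monomials_upto X (m + n))"
    by (auto simp: monomials_upto_def intro!: span_base)
qed

text \<open>
  The spans of the monomials of bounded length form an increasing chain whose union is closed
  under products, so a generating set reaches every element after finitely many steps.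
\<close>

lemma generates_imp_span_monomials_upto:
  assumes "generates X"
  shows "\<exists>n. a \<in> span (monomials_upto X n)"
proof -
  let ?U = "\<Union>n. span (monomials_upto X n)"
  have common: "\<exists>n. a \<in> span (monomials_upto X n) \<and> b \<in> span (monomials_upto X n)"
    if "a \<in> ?U" "b \<in> ?U" for a b
  proof -
    from that obtain m n where
      "a \<in> span (monomials_upto X m)" "b \<in> span (monomials_upto X n)"
      by blast
    then show ?thesis
      using span_monomials_upto_mono[of m "max m n" X] span_monomials_upto_mono[of n "max m n" X]
      by fastforce
  qed
  have "subspace ?U"
    unfolding subspace_def
  proof (intro conjI ballI allI)
    show "0 \<in> ?U" by (auto intro: span_zero)
    fix a b assume "a \<in> ?U" "b \<in> ?U"
    from common[OF this] show "a + b \<in> ?U" by (auto intro: span_add)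
  next
    fix c a assume "a \<in> ?U"
    then show "scale c a \<in> ?U" by (auto intro: span_scale)
  qed
  moreover have "one \<in> ?U"
    by (rule UN_I[of 0]) (auto simp: monomials_upto_def intro!: span_base monomial.unit)
  moreover have "a \<odot> b \<in> ?U" if "a \<in> ?U" "b \<in> ?U" for a b
    using common[OF that] by (auto intro: mult_span_monomials_upto)
  ultimately have "unital_subalgebra ?U"
    by (auto simp: unital_subalgebra_def simp del: UN_iff)
  moreover have "X \<subseteq> ?U"
    by (auto simp: monomials_upto_def intro!: exI[of _ 1] span_base monomial.generator)
  ultimately have "unital_subalgebra hull X \<subseteq> ?U"
    by (rule hull_minimal[rotated])
  then show ?thesis
    using assms by (auto simp: generates_def)
qed

lemma finite_subset_span_monomials_upto:
  assumes "generates X" "finite Y"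
  shows "\<exists>c\<ge>1. Y \<subseteq> span (monomials_upto X c)"
  using assms(2)
proof induction
  case (insert y Y)
  then obtain c where c: "c \<ge> 1" "Y \<subseteq> span (monomials_upto X c)" by blast
  obtain n where n: "y \<in> span (monomials_upto X n)"
    using generates_imp_span_monomials_upto[OF assms(1)] by blast
  show ?case
    using c n span_monomials_upto_mono[of c "max c n" X] span_monomials_upto_mono[of n "max c n" X]
    by (intro exI[of _ "max c n"]) auto
qed auto

text \<open>
  Substituting elements of filtration degree \<open>c\<close> for the letters of a monomial multiplies its
  length by at most \<open>c\<close>.
\<close>

lemma span_monomials_upto_change_generators:
  assumes "Y \<subseteq> span (monomials_upto X c)"
  shows "span (monomials_upto Y n) \<subseteq> span (monomials_upto X (c * n))"
proof -
  have "u \<in> span (monomials_upto X (c * k))" if "monomial Y k u" for k u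
    using that
  proof induction
    case unit
    show ?case by (auto simp: monomials_upto_def intro!: span_base monomial.unit)
  next
    case (generator x)
    then show ?case using assms by auto
  next
    case (product m u n v)
    then show ?case
      by (auto simp: distrib_left intro: mult_span_monomials_upto)
  qed
  then have "monomials_upto Y n \<subseteq> span (monomials_upto X (c * n))"
    using span_monomials_upto_mono[of "c * k" "c * n" X for k]
    by (fastforce simp: monomials_upto_def)
  then show ?thesis
    by (simp add: span_minimal)
qed

text \<open>
  Factors equal to the unit may be inserted into a monomial without changing its length or its
  value. Discarding them leaves finitely many bracketings of each length.
\<close>

lemma monomial_reduce:
  "monomial X n u \<Longrightarrow> n = 0 \<and> u = one \<or> n = 1 \<and> u \<in> X \<or>
     (\<exists>i j v w. i \<in> {1..<n} \<and> j \<in> {1..<n} \<and> monomial X i v \<and> monomial X j w \<and> u = v \<odot> w)"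
proof (induction rule: monomial.induct)
  case (product m u n v)
  show ?case
  proof (cases "m = 0 \<or> n = 0")
    case True
    then show ?thesis
    proof
      assume "m = 0"
      with product.IH have "u = one" by auto
      with product.IH \<open>m = 0\<close> show ?thesis by (simp add: one_mult)
    next
      assume "n = 0"
      with product.IH have "v = one" by auto
      with product.IH \<open>n = 0\<close> show ?thesis by (simp add: mult_one)
    qed
  next
    case False
    then have "m \<in> {1..<m + n}" "n \<in> {1..<m + n}" by auto
    with product.hyps show ?thesis by blast
  qed
qed auto

lemma finite_monomials:
  assumes "finite X"
  shows "finite {u. monomial X n u}"
proof (induction n rule: less_induct)
  case (less n)
  have "{u. monomial X n u} \<subseteq> insert one X \<union>
      (\<Union>i\<in>{1..<n}. \<Union>j\<in>{1..<n}. (\<lambda>(v, w). v \<odot> w) ` ({v. monomial X i v} \<times> {w. monomial X j w}))"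
    using monomial_reduce[of X n] by fastforce
  moreover have "finite \<dots>"
    using assms less by auto
  ultimately show ?case
    by (rule finite_subset)
qed

lemma finite_monomials_upto: "finite X \<Longrightarrow> finite (monomials_upto X n)"
  by (rule finite_subset[of _ "\<Union>m\<le>n. {u. monomial X m u}"])
    (auto simp: monomials_upto_def finite_monomials)

text \<open>
  The dimension of an infinite-dimensional subspace is \<open>0\<close> by convention, so monotonicity needs
  a finite spanning set of the larger space.
\<close>

lemma dim_mono_finite:
  assumes "A \<subseteq> span B" "finite B"
  shows "dim A \<le> dim B"
proof -
  obtain C where C: "C \<subseteq> B" "independent C" "B \<subseteq> span C" "card C = dim B"
    using basis_exists by blast
  have "A \<subseteq> span C"
    using assms(1) C(3) span_minimal[OF _ subspace_span] by blast
  then show ?thesis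
    using dim_le_card[of A C] C finite_subset[OF C(1) assms(2)] by simp
qed

lemma growth_change_generators:
  assumes "Y \<subseteq> span (monomials_upto X c)" "finite X"
  shows "growth Y n \<le> growth X (c * n)"
  unfolding growth_eq
  by (rule dim_mono_finite)
    (use span_monomials_upto_change_generators[OF assms(1)] span_superset[of "monomials_upto Y n"]
      finite_monomials_upto[OF assms(2)] in auto)

lemma growth_mono: "finite X \<Longrightarrow> m \<le> n \<Longrightarrow> growth X m \<le> growth X n"
  unfolding growth_eq
  using dim_mono_finite[of "monomials_upto X m" "monomials_upto X n"]
    span_monomials_upto_mono[of m n X] span_superset[of "monomials_upto X m"] finite_monomials_upto[of X n]
  by auto

text \<open>
  Passing to another generating set rescales the argument of the growth function by constant
  factors, which changes a power of the argument by constant factors only; these disappear when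
  logarithms are divided by \<open>ln n\<close>.
\<close>

lemma GKdim_eq_if_growth_power:
  assumes X: "finite X" "generates X" and Y: "finite Y" "generates Y" and "0 < A" "0 \<le> r"
    and lower: "\<And>n. n \<ge> 1 \<Longrightarrow> A * real n powr r \<le> growth X n"
    and upper: "\<And>n. n \<ge> 1 \<Longrightarrow> growth X n \<le> B * real n powr r"
  shows "upper_GKdim Y = ereal r" "lower_GKdim Y = ereal r"
proof -
  obtain c where c: "c \<ge> 1" "Y \<subseteq> span (monomials_upto X c)"
    using finite_subset_span_monomials_upto X Y by metis
  obtain d where d: "d \<ge> 1" "X \<subseteq> span (monomials_upto Y d)"
    using finite_subset_span_monomials_upto X Y by metis
  define A' where "A' = A * (1 / (2 * real d)) powr r"
  define B' where "B' = B * real c powr r"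
  have "A \<le> B"
    using lower[of 1] upper[of 1] by simp
  then have pos: "A' > 0" "B' > 0"
    using \<open>0 < A\<close> c d by (auto simp: A'_def B'_def)
  have up: "growth Y n \<le> B' * real n powr r" if "n \<ge> 1" for n
  proof -
    have "real (growth Y n) \<le> growth X (c * n)"
      using growth_change_generators[OF c(2) X(1)] by simp
    also have "\<dots> \<le> B * real (c * n) powr r"
      using c(1) that by (intro upper) auto
    finally show ?thesis
      by (simp add: B'_def powr_mult mult.assoc)
  qed
  have low: "A' * real n powr r \<le> growth Y n" if "n \<ge> d" for n
  proof -
    \<comment> \<open>Rounding costs a factor of at most \<open>2\<close>: \<open>k \<ge> n / (2 d)\<close> as soon as \<open>n \<ge> d\<close>.\<close>
    define k where "k = n div d"
    have "k \<ge> 1"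
      using that d(1) by (simp add: k_def div_greater_zero_iff Suc_leI)
    have "n < d * k + d"
      using d(1) by (metis k_def mult_div_mod_eq mod_less_divisor nat_add_left_cancel_less
          less_le_trans zero_less_one)
    also have "\<dots> \<le> d * k + d * k"
      using \<open>k \<ge> 1\<close> by simp
    finally have "real n < real (d * k + d * k)"
      by (simp only: of_nat_less_iff)
    then have "1 / (2 * real d) * real n \<le> k"
      using d(1) by (simp add: field_simps)
    then have "(1 / (2 * real d) * real n) powr r \<le> real k powr r"
      using \<open>0 \<le> r\<close> by (intro powr_mono2) auto
    then have "A' * real n powr r \<le> A * real k powr r"
      using \<open>0 < A\<close> by (simp add: A'_def powr_mult[symmetric] mult.assoc)
    also have "\<dots> \<le> growth X k"
      using lower \<open>k \<ge> 1\<close> by simp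
    also have "\<dots> \<le> growth Y (d * k)"
      using growth_change_generators[OF d(2) Y(1)] by simp
    also have "\<dots> \<le> growth Y n"
      using growth_mono[OF Y(1), of "d * k" n] by (simp add: k_def)
    finally show ?thesis by simp
  qed
  have "(\<lambda>n. ln (real (growth Y n)) / ln (real n)) \<longlonglongrightarrow> r"
  proof (rule tendsto_sandwich)
    have "ln A' + r * ln (real n) \<le> ln (real (growth Y n))" if "n \<ge> max 2 d" for n
    proof -
      have "ln A' + r * ln (real n) = ln (A' * real n powr r)"
        using that pos by (simp add: ln_mult ln_powr)
      also have "\<dots> \<le> ln (real (growth Y n))"
        using low[of n] that pos by (intro ln_mono) auto
      finally show ?thesis .
    qed
    then show "\<forall>\<^sub>F n in sequentially. (ln A' + r * ln (real n)) / ln (real n)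
        \<le> ln (real (growth Y n)) / ln (real n)"
      by (intro eventually_sequentiallyI[of "max 2 d"] divide_right_mono) auto
    have "ln (real (growth Y n)) \<le> ln B' + r * ln (real n)" if "n \<ge> max 2 d" for n
    proof -
      have "A' * real n powr r > 0"
        using that pos by simp
      then have "ln (real (growth Y n)) \<le> ln (B' * real n powr r)"
        using up[of n] low[of n] that by (intro ln_mono) auto
      also have "\<dots> = ln B' + r * ln (real n)"
        using that pos by (simp add: ln_mult ln_powr)
      finally show ?thesis .
    qed
    then show "\<forall>\<^sub>F n in sequentially. ln (real (growth Y n)) / ln (real n)
        \<le> (ln B' + r * ln (real n)) / ln (real n)"
      by (intro eventually_sequentiallyI[of "max 2 d"] divide_right_mono) auto
    show "(\<lambda>n. (ln A' + r * ln (real n)) / ln (real n)) \<longlonglongrightarrow> r"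
      "(\<lambda>n. (ln B' + r * ln (real n)) / ln (real n)) \<longlonglongrightarrow> r"
      by real_asymp+
  qed
  then have lim: "(\<lambda>n. ereal (ln (real (growth Y n)) / ln (real n))) \<longlonglongrightarrow> ereal r"
    by simp
  show "upper_GKdim Y = ereal r" "lower_GKdim Y = ereal r"
    unfolding upper_GKdim_def lower_GKdim_def
    using lim lim_imp_Limsup[OF _ lim] lim_imp_Liminf[OF _ lim] by simp_all
qed

end

section \<open>Vectors with coordinates\<close>

definition scale :: "'k::field \<Rightarrow> (nat \<Rightarrow>\<^sub>0 'k) \<Rightarrow> (nat \<Rightarrow>\<^sub>0 'k)" where
  "scale c a = Abs_poly_mapping (\<lambda>i. c * Poly_Mapping.lookup a i)"

lemma lookup_scale: "Poly_Mapping.lookup (scale c a) i = c * Poly_Mapping.lookup a i"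
proof -
  have "finite {i. c * Poly_Mapping.lookup a i \<noteq> 0}"
    by (rule finite_subset[OF _ finite_lookup[of a]]) auto
  then show ?thesis by (simp add: scale_def)
qed

interpretation vector_space scale
  by unfold_locales
    (auto intro!: poly_mapping_eqI simp: lookup_scale lookup_add algebra_simps)

definition finite_on :: "'b set \<Rightarrow> ('b \<Rightarrow> 'k::zero) \<Rightarrow> bool" where
  "finite_on B g \<longleftrightarrow> finite {b. g b \<noteq> 0} \<and> {b. g b \<noteq> 0} \<subseteq> B"

lemma finite_onI: "finite A \<Longrightarrow> A \<subseteq> B \<Longrightarrow> (\<And>b. g b \<noteq> 0 \<Longrightarrow> b \<in> A) \<Longrightarrow> finite_on B g"
  using finite_subset[of "{b. g b \<noteq> 0}" A] by (auto simp: finite_on_def)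

lemma finite_on_mem: "finite_on B g \<Longrightarrow> g b \<noteq> 0 \<Longrightarrow> b \<in> B"
  by (auto simp: finite_on_def)

text \<open>
  The type of finitely supported functions on \<open>nat\<close> serves as the free vector space on an arbitrary
  countably infinite set \<open>B\<close>, by means of an enumeration of \<open>B\<close>. Structures are then described by
  functions on \<open>B\<close>, with the value \<open>0\<close> outside of \<open>B\<close>.
\<close>

locale coordinates =
  fixes B :: "'b set" and index :: "'b \<Rightarrow> nat"
  assumes bij_index: "bij_betw index B UNIV"
begin

definition coef :: "(nat \<Rightarrow>\<^sub>0 'k::field) \<Rightarrow> 'b \<Rightarrow> 'k" where
  "coef a b = (if b \<in> B then Poly_Mapping.lookup a (index b) else 0)"

definition vec :: "('b \<Rightarrow> 'k::field) \<Rightarrow> (nat \<Rightarrow>\<^sub>0 'k)" where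
  "vec g = Abs_poly_mapping (\<lambda>i. g (inv_into B index i))"

lemma coef_vec:
  assumes "finite_on B g"
  shows "coef (vec g) = g"
proof
  fix b
  have "{i. g (inv_into B index i) \<noteq> 0} \<subseteq> index ` {b. g b \<noteq> 0}"
  proof
    fix i assume "i \<in> {i. g (inv_into B index i) \<noteq> 0}"
    moreover have "i = index (inv_into B index i)"
      using bij_betw_inv_into_right[OF bij_index] by simp
    ultimately show "i \<in> index ` {b. g b \<noteq> 0}"
      by blast
  qed
  then have "finite {i. g (inv_into B index i) \<noteq> 0}"
    using assms finite_surj by (auto simp: finite_on_def)
  then show "coef (vec g) b = g b"
    using assms bij_betw_inv_into_left[OF bij_index]
    by (auto simp: coef_def vec_def finite_on_def)
qed

lemma finite_on_coef: "finite_on B (coef a)"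
proof -
  have "index ` {b. coef a b \<noteq> 0} \<subseteq> Poly_Mapping.keys a"
    by (auto simp: coef_def in_keys_iff)
  moreover have "inj_on index {b. coef a b \<noteq> 0}"
    using bij_index by (auto simp: coef_def bij_betw_def inj_on_def)
  ultimately have "finite {b. coef a b \<noteq> 0}"
    using finite_keys finite_subset finite_imageD by blast
  then show ?thesis
    by (auto simp: finite_on_def coef_def)
qed

lemma coef_eqI:
  assumes "\<And>b. coef a b = coef a' b"
  shows "a = a'"
proof (rule poly_mapping_eqI)
  fix i
  obtain b where "b \<in> B" "i = index b"
    using bij_index by (metis UNIV_I bij_betw_imp_surj_on imageE)
  with assms[of b] show "Poly_Mapping.lookup a i = Poly_Mapping.lookup a' i"
    by (simp add: coef_def)
qed

lemma coef_add: "coef (a + a') b = coef a b + coef a' b"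
  and coef_zero: "coef 0 b = 0"
  and coef_sum: "coef (\<Sum>i\<in>I. h i) b = (\<Sum>i\<in>I. coef (h i) b)"
  and coef_scale: "coef (scale c a) b = c * coef a b"
  by (simp_all add: coef_def lookup_add lookup_sum lookup_scale)

lemmas coef_linear = coef_add coef_zero coef_sum coef_scale

definition unit_vec :: "'b \<Rightarrow> (nat \<Rightarrow>\<^sub>0 'k::field)" where
  "unit_vec b = vec (\<lambda>c. if c = b then 1 else 0)"

lemma coef_unit_vec: "b \<in> B \<Longrightarrow> coef (unit_vec b) c = (if c = b then 1 else 0)"
  unfolding unit_vec_def by (subst coef_vec) (auto simp: finite_on_def)

definition coord_space :: "'b set \<Rightarrow> (nat \<Rightarrow>\<^sub>0 'k::field) set" where
  "coord_space C = {a. \<forall>b. coef a b \<noteq> 0 \<longrightarrow> b \<in> C}"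

lemma subspace_coord_space: "subspace (coord_space C :: (nat \<Rightarrow>\<^sub>0 'k::field) set)"
proof (rule subspaceI)
  fix a a' :: "nat \<Rightarrow>\<^sub>0 'k" assume "a \<in> coord_space C" "a' \<in> coord_space C"
  then have "b \<notin> C \<Longrightarrow> coef a b = 0" "b \<notin> C \<Longrightarrow> coef a' b = 0" for b
    by (auto simp: coord_space_def)
  then have "b \<notin> C \<Longrightarrow> coef (a + a') b = 0" for b
    by (simp add: coef_add)
  then show "a + a' \<in> coord_space C"
    by (auto simp: coord_space_def)
qed (auto simp: coord_space_def coef_zero coef_scale)

lemma sum_unit_vec: "a = (\<Sum>b | coef a b \<noteq> 0. scale (coef a b) (unit_vec b))"
proof (rule coef_eqI)
  fix c
  have fin: "finite {b. coef a b \<noteq> 0}" and sub: "{b. coef a b \<noteq> 0} \<subseteq> B"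
    using finite_on_coef[of a] by (auto simp: finite_on_def)
  have "coef (\<Sum>b | coef a b \<noteq> 0. scale (coef a b) (unit_vec b)) c
      = (\<Sum>b | coef a b \<noteq> 0. if b = c then coef a c else 0)"
    unfolding coef_sum using sub by (intro sum.cong) (auto simp: coef_scale coef_unit_vec)
  also have "\<dots> = coef a c"
    using fin by simp
  finally show "coef a c = coef (\<Sum>b | coef a b \<noteq> 0. scale (coef a b) (unit_vec b)) c" ..
qed

lemma coord_space_subset:
  fixes A :: "(nat \<Rightarrow>\<^sub>0 'k::field) set"
  assumes "subspace A" "\<And>b. b \<in> B \<Longrightarrow> b \<in> C \<Longrightarrow> unit_vec b \<in> A"
  shows "coord_space C \<subseteq> A"
proof
  fix a :: "nat \<Rightarrow>\<^sub>0 'k" assume a: "a \<in> coord_space C"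
  have "{b. coef a b \<noteq> 0} \<subseteq> B"
    using finite_on_coef[of a] by (auto simp: finite_on_def)
  with a have "(\<Sum>b | coef a b \<noteq> 0. scale (coef a b) (unit_vec b)) \<in> A"
    using assms by (intro subspace_sum subspace_scale) (auto simp: coord_space_def)
  then show "a \<in> A"
    by (simp flip: sum_unit_vec)
qed

lemma dim_coord_space:
  assumes "C \<subseteq> B"
  shows "dim (coord_space C :: (nat \<Rightarrow>\<^sub>0 'k::field) set) = card C"
proof -
  let ?E = "unit_vec ` C :: (nat \<Rightarrow>\<^sub>0 'k) set"
  have span: "span (unit_vec ` D) = (coord_space D :: (nat \<Rightarrow>\<^sub>0 'k) set)" if "D \<subseteq> B" for D
  proof
    show "span (unit_vec ` D) \<subseteq> (coord_space D :: (nat \<Rightarrow>\<^sub>0 'k) set)"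
      using that by (intro span_minimal subspace_coord_space)
        (auto simp: coord_space_def coef_unit_vec split: if_splits)
    show "(coord_space D :: (nat \<Rightarrow>\<^sub>0 'k) set) \<subseteq> span (unit_vec ` D)"
      by (rule coord_space_subset[OF subspace_span]) (auto intro: span_base)
  qed
  have inj: "inj_on (unit_vec :: _ \<Rightarrow> (nat \<Rightarrow>\<^sub>0 'k)) C"
  proof (rule inj_onI)
    fix b c assume "b \<in> C" "c \<in> C" and eq: "(unit_vec b :: nat \<Rightarrow>\<^sub>0 'k) = unit_vec c"
    then have "coef (unit_vec b :: nat \<Rightarrow>\<^sub>0 'k) b = 1"
      using assms by (intro trans[OF coef_unit_vec]) auto
    moreover have "coef (unit_vec c :: nat \<Rightarrow>\<^sub>0 'k) b = (if b = c then 1 else 0)"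
      using \<open>c \<in> C\<close> assms by (intro coef_unit_vec) auto
    ultimately show "b = c" using eq by (simp split: if_splits)
  qed
  have "independent ?E"
    unfolding dependent_def
  proof
    assume "\<exists>a\<in>?E. a \<in> span (?E - {a})"
    then obtain b where b: "b \<in> C" "unit_vec b \<in> span (?E - {unit_vec b})"
      by blast
    have "?E - {unit_vec b} = unit_vec ` (C - {b})"
      using inj b(1) by (auto simp: inj_on_def)
    with b have "unit_vec b \<in> (coord_space (C - {b}) :: (nat \<Rightarrow>\<^sub>0 'k) set)"
      using span[of "C - {b}"] assms by auto
    then have "coef (unit_vec b :: nat \<Rightarrow>\<^sub>0 'k) b = 0"
      by (auto simp: coord_space_def)
    then show False
      using b(1) assms by (simp add: coef_unit_vec subset_iff)
  qed
  then have "dim (span ?E) = card ?E"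
    by (rule dim_span_eq_card_independent)
  then show ?thesis
    using span[OF assms] card_image[OF inj] by simp
qed

text \<open>Any partition of the basis, here into the fibres of \<open>g\<close>, yields a direct sum decomposition.\<close>

lemma coord_space_decomposition:
  "\<exists>!f. (\<forall>i. f i \<in> coord_space {b. g b = i}) \<and> finite {i. f i \<noteq> 0} \<and>
     a = (\<Sum>i | f i \<noteq> 0. f i)"
proof -
  define h where "h i = vec (\<lambda>b. if g b = i then coef a b else 0)" for i
  have coef_h: "coef (h i) b = (if g b = i then coef a b else 0)" for i b
    unfolding h_def using finite_on_coef[of a]
    by (subst coef_vec) (auto simp: finite_on_def intro: rev_finite_subset)
  show ?thesis
  proof (rule ex1I[of _ h])
    have "{i. h i \<noteq> 0} \<subseteq> g ` {b. coef a b \<noteq> 0}"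
    proof
      fix i assume "i \<in> {i. h i \<noteq> 0}"
      then obtain b where "coef (h i) b \<noteq> 0"
        using coef_eqI[of "h i" 0] by (auto simp: coef_zero)
      then show "i \<in> g ` {b. coef a b \<noteq> 0}"
        by (auto simp: coef_h split: if_splits)
    qed
    then have fin: "finite {i. h i \<noteq> 0}"
      using finite_on_coef[of a] by (auto simp: finite_on_def intro: finite_surj)
    moreover have "a = (\<Sum>i | h i \<noteq> 0. h i)"
    proof (rule coef_eqI)
      fix b
      have "coef (\<Sum>i | h i \<noteq> 0. h i) b = (\<Sum>i | h i \<noteq> 0. if i = g b then coef a b else 0)"
        unfolding coef_sum by (rule sum.cong[OF refl]) (auto simp: coef_h)
      also have "\<dots> = (if h (g b) \<noteq> 0 then coef a b else 0)"
        using fin by (simp add: sum.delta)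
      also have "\<dots> = coef a b"
        using coef_h[of "g b" b] by (auto simp: coef_zero)
      finally show "coef a b = coef (\<Sum>i | h i \<noteq> 0. h i) b" ..
    qed
    moreover have "h i \<in> coord_space {b. g b = i}" for i
      by (simp add: coord_space_def coef_h)
    ultimately show "(\<forall>i. h i \<in> coord_space {b. g b = i}) \<and> finite {i. h i \<noteq> 0} \<and>
       a = (\<Sum>i | h i \<noteq> 0. h i)"
      by (intro conjI allI)
  next
    fix f assume f: "(\<forall>i. f i \<in> coord_space {b. g b = i}) \<and> finite {i. f i \<noteq> 0} \<and>
       a = (\<Sum>i | f i \<noteq> 0. f i)"
    note f_in = f[THEN conjunct1, rule_format] and fin = f[THEN conjunct2, THEN conjunct1]
      and a_eq = f[THEN conjunct2, THEN conjunct2]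
    have zero: "coef (f i) b = 0" if "g b \<noteq> i" for i b
      using f_in[of i] that unfolding coord_space_def by blast
    have "coef a b = coef (f (g b)) b" for b
    proof -
      have "coef a b = (\<Sum>i | f i \<noteq> 0. coef (f i) b)"
        by (subst a_eq) (rule coef_sum)
      also have "\<dots> = (\<Sum>i | f i \<noteq> 0. if i = g b then coef (f (g b)) b else 0)"
        by (intro sum.cong) (auto simp: zero)
      also have "\<dots> = coef (f (g b)) b"
        using fin by (simp add: sum.delta coef_zero)
      finally show ?thesis .
    qed
    then show "f = h"
      by (intro ext coef_eqI) (auto simp: coef_h zero)
  qed
qed

end

section \<open>The Jordan double of a graded Lie algebra\<close>

text \<open>
  Basis of the double: the unit \<open>U\<close>, the element \<open>X\<close>, and for every basis element \<open>l\<close> of the Lie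
  algebra the element \<open>V l\<close> and its odd copy \<open>Q l\<close>.
\<close>

datatype 'l double = U | X | V 'l | Q 'l

abbreviation unit_at :: "'b \<Rightarrow> 'b \<Rightarrow> 'k::zero_neq_one" where
  "unit_at b \<equiv> (\<lambda>b'. if b' = b then 1 else 0)"

text \<open>
  A graded Lie algebra with basis \<open>B\<close> in coordinates: vectors are functions that are finitely
  supported on \<open>B\<close>. Linearity of the bracket refers to all functions, which avoids side conditions
  on supports. The last assumption says that \<open>x\<close> and \<open>y\<close> generate, in the form of
  an induction principle.
\<close>

locale graded_lie_algebra =
  fixes B :: "'l set" and deg :: "'l \<Rightarrow> nat"
    and br :: "('l \<Rightarrow> 'k::field) \<Rightarrow> ('l \<Rightarrow> 'k) \<Rightarrow> 'l \<Rightarrow> 'k" and x y :: 'l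
  assumes infinite_basis: "infinite B"
    and finite_degree: "finite {l \<in> B. deg l = n}"
    and deg_pos: "l \<in> B \<Longrightarrow> 0 < deg l"
    and gens: "x \<in> B" "y \<in> B" "x \<noteq> y" "deg x = 1" "deg y = 1"
    and br_add: "br (\<lambda>l. f l + f' l) g = (\<lambda>l. br f g l + br f' g l)"
    and br_scale: "br (\<lambda>l. c * f l) g = (\<lambda>l. c * br f g l)"
    and br_antisym: "br f g l = - br g f l"
    and br_graded: "finite_on B f \<Longrightarrow> finite_on B g \<Longrightarrow> br f g l \<noteq> 0 \<Longrightarrow>
      l \<in> B \<and> (\<exists>l1 l2. f l1 \<noteq> 0 \<and> g l2 \<noteq> 0 \<and> deg l = deg l1 + deg l2)"
    and jacobi: "finite_on B f \<Longrightarrow> finite_on B g \<Longrightarrow> finite_on B h \<Longrightarrow>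
      br (br f g) h l + br (br g h) f l + br (br h f) g l = 0"
    and br_gens: "br (unit_at x) (unit_at y) \<noteq> (\<lambda>_. 0)"
    and generated: "l \<in> B \<Longrightarrow> P (unit_at x) \<Longrightarrow> P (unit_at y) \<Longrightarrow>
      (\<And>f g. finite_on B f \<Longrightarrow> finite_on B g \<Longrightarrow> P f \<Longrightarrow> P g \<Longrightarrow> P (\<lambda>l. f l + g l)) \<Longrightarrow>
      (\<And>f c. finite_on B f \<Longrightarrow> P f \<Longrightarrow> P (\<lambda>l. c * f l)) \<Longrightarrow>
      (\<And>f g. finite_on B f \<Longrightarrow> finite_on B g \<Longrightarrow> P f \<Longrightarrow> P g \<Longrightarrow> P (br f g)) \<Longrightarrow>
      P (unit_at l)"
begin

lemma br_add2: "br f (\<lambda>l. g l + g' l) = (\<lambda>l. br f g l + br f g' l)"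
  by (rule ext, subst br_antisym, simp add: br_add br_antisym[of f])

lemma br_scale2: "br f (\<lambda>l. c * g l) = (\<lambda>l. c * br f g l)"
  by (rule ext, subst br_antisym, simp add: br_scale br_antisym[of f])

lemma br_zero: "br (\<lambda>_. 0) g = (\<lambda>_. 0)" "br f (\<lambda>_. 0) = (\<lambda>_. 0)"
  using br_scale[of 0 "\<lambda>_. 0" g] br_scale2[of f 0 "\<lambda>_. 0"] by simp_all

lemma finite_on_of_bounded:
  assumes "\<And>l. f l \<noteq> 0 \<Longrightarrow> l \<in> B \<and> deg l \<le> n"
  shows "finite_on B f"
proof -
  have "{l. f l \<noteq> 0} \<subseteq> (\<Union>i\<le>n. {l \<in> B. deg l = i})"
    using assms by auto
  then have "finite {l. f l \<noteq> 0}"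
    by (rule finite_subset) (use finite_degree in auto)
  with assms show ?thesis by (auto simp: finite_on_def)
qed

lemma finite_on_bounded:
  assumes "finite_on B f"
  shows "\<exists>n. \<forall>l. f l \<noteq> 0 \<longrightarrow> deg l \<le> n"
  using assms by (intro exI[of _ "Max (deg ` {l. f l \<noteq> 0})"]) (auto simp: finite_on_def)

lemma finite_on_br:
  assumes "finite_on B f" "finite_on B g"
  shows "finite_on B (br f g)"
proof -
  obtain m n where "\<forall>l. f l \<noteq> 0 \<longrightarrow> deg l \<le> m" "\<forall>l. g l \<noteq> 0 \<longrightarrow> deg l \<le> n"
    using finite_on_bounded assms by metis
  then show ?thesis
    using br_graded[OF assms] by (intro finite_on_of_bounded[of _ "m + n"]) (metis add_mono)
qed

definition dbasis :: "'l double set" where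
  "dbasis = {U, X} \<union> V ` B \<union> Q ` B"

text \<open>
  Multiplication by \<open>X\<close> raises the degree by \<open>1\<close>, so \<open>V l\<close> and \<open>Q l\<close> must differ by \<open>1\<close>; a product of
  two copies is a bracket, so the degree \<open>f d\<close> of \<open>V l\<close>, where \<open>d = deg l\<close>, has to
  satisfy \<open>f (d + d') = f d + f d' + 2\<close>. With \<open>f 1 = 1\<close> this forces \<open>f d = 3 d - 2\<close>.
\<close>

primrec ddeg :: "'l double \<Rightarrow> nat" where
  "ddeg U = 0" | "ddeg X = 1" | "ddeg (V l) = 3 * deg l - 2" | "ddeg (Q l) = 3 * deg l - 1"

primrec parity :: "'l double \<Rightarrow> bit" where
  "parity U = 0" | "parity X = 1" | "parity (V l) = 0" | "parity (Q l) = 1"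

lemma dbasis_simps [simp]: "U \<in> dbasis" "X \<in> dbasis" "V l \<in> dbasis \<longleftrightarrow> l \<in> B" "Q l \<in> dbasis \<longleftrightarrow> l \<in> B"
  by (auto simp: dbasis_def)

lemma finite_deg_le: "finite {l \<in> B. deg l \<le> n}"
proof -
  have "{l \<in> B. deg l \<le> n} = (\<Union>i\<le>n. {l \<in> B. deg l = i})"
    by auto
  then show ?thesis
    using finite_degree by simp
qed

lemma finite_ddeg_le: "finite {b \<in> dbasis. ddeg b \<le> n}"
proof -
  have "{b \<in> dbasis. ddeg b \<le> n} \<subseteq>
      {U, X} \<union> V ` {l \<in> B. deg l \<le> n + 2} \<union> Q ` {l \<in> B. deg l \<le> n + 2}"
    by (auto simp: dbasis_def)
  then show ?thesis
    by (rule finite_subset) (use finite_deg_le in auto)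
qed

lemma countable_dbasis: "countable dbasis"
proof -
  have "countable (\<Union>n. {b \<in> dbasis. ddeg b \<le> n})"
    by (rule countable_UN) (simp_all add: countable_finite finite_ddeg_le)
  moreover have "(\<Union>n. {b \<in> dbasis. ddeg b \<le> n}) = dbasis"
    by auto
  ultimately show ?thesis
    by simp
qed

lemma infinite_dbasis: "infinite dbasis"
proof
  assume "finite dbasis"
  then have "finite (V ` B)"
    by (rule rev_finite_subset) (auto simp: dbasis_def)
  then have "finite B"
    by (rule finite_imageD) (simp add: inj_on_def)
  then show False
    using infinite_basis by simp
qed

sublocale coordinates dbasis "to_nat_on dbasis"
  by unfold_locales (rule to_nat_on_infinite[OF countable_dbasis infinite_dbasis])

text \<open>
  The coordinates of a product: \<open>U\<close> is the unit, copies multiply by the bracket, and \<open>X\<close> sends \<open>V l\<close>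
  to \<open>Q l\<close> from both sides because \<open>V l\<close> is even.
\<close>

primrec prod :: "('l double \<Rightarrow> 'k) \<Rightarrow> ('l double \<Rightarrow> 'k) \<Rightarrow> 'l double \<Rightarrow> 'k" where
  "prod a b U = a U * b U"
| "prod a b X = a U * b X + a X * b U"
| "prod a b (V l) = a U * b (V l) + a (V l) * b U + br (\<lambda>l. a (Q l)) (\<lambda>l. b (Q l)) l"
| "prod a b (Q l) = a U * b (Q l) + a (Q l) * b U + (a X * b (V l) + a (V l) * b X)"

lemma finite_on_component:
  assumes "finite_on dbasis a"
  shows "finite_on B (\<lambda>l. a (V l))" "finite_on B (\<lambda>l. a (Q l))"
proof -
  have fin: "finite {b. a b \<noteq> 0}" and sub: "{b. a b \<noteq> 0} \<subseteq> dbasis"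
    using assms by (auto simp: finite_on_def)
  have "finite {l. a (V l) \<noteq> 0}" "finite {l. a (Q l) \<noteq> 0}"
    using finite_vimageI[OF fin, of V] finite_vimageI[OF fin, of Q]
    by (simp_all add: vimage_def inj_def)
  moreover have "{l. a (V l) \<noteq> 0} \<subseteq> B" "{l. a (Q l) \<noteq> 0} \<subseteq> B"
    using sub dbasis_simps(3,4) by blast+
  ultimately show "finite_on B (\<lambda>l. a (V l))" "finite_on B (\<lambda>l. a (Q l))"
    by (simp_all add: finite_on_def)
qed

text \<open>One statement for the \<open>\<nat>\<close>-grading and the parity; it also yields finite supports of products.\<close>

lemma prod_graded:
  assumes a: "finite_on dbasis a" and b: "finite_on dbasis b" and nz: "prod a b c \<noteq> 0"
  shows "c \<in> dbasis \<and> (\<exists>c1 c2. a c1 \<noteq> 0 \<and> b c2 \<noteq> 0 \<and> ddeg c = ddeg c1 + ddeg c2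
    \<and> parity c = parity c1 + parity c2)"
proof -
  consider "a U * b c \<noteq> 0" | "a c * b U \<noteq> 0"
    | l where "c = V l" "br (\<lambda>l. a (Q l)) (\<lambda>l. b (Q l)) l \<noteq> 0"
    | l where "c = Q l" "a X * b (V l) \<noteq> 0" | l where "c = Q l" "a (V l) * b X \<noteq> 0"
    using nz by (cases c) (auto, (metis add.right_neutral mult_zero_left mult_zero_right)+)
  then show ?thesis
  proof cases
    case 1
    then show ?thesis
      using finite_on_mem[OF b, of c] by (intro conjI exI[of _ U] exI[of _ c]) auto
  next
    case 2
    then show ?thesis
      using finite_on_mem[OF a, of c] by (intro conjI exI[of _ U] exI[of _ c]) auto
  next
    case (3 l)
    from br_graded[OF finite_on_component(2)[OF a] finite_on_component(2)[OF b] 3(2)]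
    obtain l1 l2 where l: "l \<in> B" "a (Q l1) \<noteq> 0" "b (Q l2) \<noteq> 0" "deg l = deg l1 + deg l2"
      by blast
    then have "l1 \<in> B" "l2 \<in> B"
      using finite_on_mem[OF a, of "Q l1"] finite_on_mem[OF b, of "Q l2"] by simp_all
    then have "ddeg (V l) = ddeg (Q l1) + ddeg (Q l2)"
      using deg_pos[of l1] deg_pos[of l2] l(4) by simp
    with 3 l show ?thesis
      by (intro conjI exI[of _ "Q l1"] exI[of _ "Q l2"]) simp_all
  next
    case (4 l)
    then have "l \<in> B"
      using finite_on_mem[OF b, of "V l"] by simp
    with 4 deg_pos[of l] show ?thesis
      by (intro conjI exI[of _ X] exI[of _ "V l"]) simp_all
  next
    case (5 l)
    then have "l \<in> B"
      using finite_on_mem[OF a, of "V l"] by simp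
    with 5 deg_pos[of l] show ?thesis
      by (intro conjI exI[of _ "V l"] exI[of _ X]) simp_all
  qed
qed

lemma finite_on_ddeg_bounded:
  assumes "finite_on dbasis a"
  shows "\<exists>n. \<forall>c. a c \<noteq> 0 \<longrightarrow> ddeg c \<le> n"
  using assms by (intro exI[of _ "Max (ddeg ` {c. a c \<noteq> 0})"]) (auto simp: finite_on_def)

lemma finite_on_prod:
  assumes "finite_on dbasis a" "finite_on dbasis b"
  shows "finite_on dbasis (prod a b)"
proof -
  obtain m n where mn: "\<forall>c. a c \<noteq> 0 \<longrightarrow> ddeg c \<le> m" "\<forall>c. b c \<noteq> 0 \<longrightarrow> ddeg c \<le> n"
    using finite_on_ddeg_bounded assms by metis
  have sub: "{c. prod a b c \<noteq> 0} \<subseteq> {c \<in> dbasis. ddeg c \<le> m + n}"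
  proof
    fix c assume "c \<in> {c. prod a b c \<noteq> 0}"
    then obtain c1 c2 where "c \<in> dbasis" "a c1 \<noteq> 0" "b c2 \<noteq> 0" "ddeg c = ddeg c1 + ddeg c2"
      using prod_graded[OF assms, of c] by blast
    then show "c \<in> {c \<in> dbasis. ddeg c \<le> m + n}"
      using mn add_mono[of "ddeg c1" m "ddeg c2" n] by simp
  qed
  then have "finite {c. prod a b c \<noteq> 0}"
    using finite_ddeg_le by (rule finite_subset)
  with sub show ?thesis
    by (auto simp: finite_on_def)
qed

definition mult :: "(nat \<Rightarrow>\<^sub>0 'k) \<Rightarrow> (nat \<Rightarrow>\<^sub>0 'k) \<Rightarrow> (nat \<Rightarrow>\<^sub>0 'k)" (infixl \<open>\<odot>\<close> 70) where
  "a \<odot> b = vec (prod (coef a) (coef b))"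

lemma coef_mult: "coef (a \<odot> b) = prod (coef a) (coef b)"
  unfolding mult_def by (intro coef_vec finite_on_prod finite_on_coef)

end

context graded_lie_algebra
begin

lemma unital_algebra: "unital_algebra scale (\<odot>) (unit_vec U)"
proof (intro unital_algebra.intro unital_algebra_axioms.intro vector_space_axioms)
  fix a b :: "nat \<Rightarrow>\<^sub>0 'k"
  show "Vector_Spaces.linear scale scale (\<lambda>a. a \<odot> b)"
    unfolding Vector_Spaces.linear_iff
  proof (intro conjI allI)
    show "(v + w) \<odot> b = v \<odot> b + w \<odot> b" for v w
    proof (rule coef_eqI)
      show "coef ((v + w) \<odot> b) c = coef (v \<odot> b + w \<odot> b) c" for c
        by (cases c) (simp_all add: coef_linear coef_mult br_add algebra_simps)
    qed
    show "scale k v \<odot> b = scale k (v \<odot> b)" for k v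
    proof (rule coef_eqI)
      show "coef (scale k v \<odot> b) c = coef (scale k (v \<odot> b)) c" for c
        by (cases c) (simp_all add: coef_linear coef_mult br_scale algebra_simps)
    qed
  qed (rule vector_space_axioms)+
  show "Vector_Spaces.linear scale scale (\<lambda>b. a \<odot> b)"
    unfolding Vector_Spaces.linear_iff
  proof (intro conjI allI)
    show "a \<odot> (v + w) = a \<odot> v + a \<odot> w" for v w
    proof (rule coef_eqI)
      show "coef (a \<odot> (v + w)) c = coef (a \<odot> v + a \<odot> w) c" for c
        by (cases c) (simp_all add: coef_linear coef_mult br_add2 algebra_simps)
    qed
    show "a \<odot> scale k v = scale k (a \<odot> v)" for k v
    proof (rule coef_eqI)
      show "coef (a \<odot> scale k v) c = coef (scale k (a \<odot> v)) c" for c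
        by (cases c) (simp_all add: coef_linear coef_mult br_scale2 algebra_simps)
    qed
  qed (rule vector_space_axioms)+
  show "unit_vec U \<odot> a = a"
  proof (rule coef_eqI)
    show "coef (unit_vec U \<odot> a) c = coef a c" for c
      by (cases c) (simp_all add: coef_unit_vec coef_mult br_zero)
  qed
  show "a \<odot> unit_vec U = a"
  proof (rule coef_eqI)
    show "coef (a \<odot> unit_vec U) c = coef a c" for c
      by (cases c) (simp_all add: coef_unit_vec coef_mult br_zero)
  qed
qed

definition homogeneous :: "bit \<Rightarrow> ('l double \<Rightarrow> 'k) \<Rightarrow> bool" where
  "homogeneous p a \<longleftrightarrow> (\<forall>b. a b \<noteq> 0 \<longrightarrow> parity b = p)"

definition part :: "bit \<Rightarrow> (nat \<Rightarrow>\<^sub>0 'k) set" where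
  "part p = coord_space {b. parity b = p}"

lemma part_iff: "a \<in> part p \<longleftrightarrow> homogeneous p (coef a)"
  by (simp add: part_def coord_space_def homogeneous_def)

primrec even_elt :: "'k \<Rightarrow> ('l \<Rightarrow> 'k) \<Rightarrow> 'l double \<Rightarrow> 'k" where
  "even_elt u v U = u" | "even_elt u v X = 0" | "even_elt u v (V l) = v l" | "even_elt u v (Q l) = 0"

primrec odd_elt :: "'k \<Rightarrow> ('l \<Rightarrow> 'k) \<Rightarrow> 'l double \<Rightarrow> 'k" where
  "odd_elt u v U = 0" | "odd_elt u v X = u" | "odd_elt u v (V l) = 0" | "odd_elt u v (Q l) = v l"

lemma homogeneous_cases:
  assumes "homogeneous p a" "finite_on dbasis a"
  shows "\<exists>u v. finite_on B v \<and> (p = 0 \<and> a = even_elt u v \<or> p = 1 \<and> a = odd_elt u v)"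
proof (cases p)
  case zero
  have "a c = even_elt (a U) (\<lambda>l. a (V l)) c" for c
    using assms(1) zero by (cases c) (auto simp: homogeneous_def)
  then show ?thesis
    using zero finite_on_component(1)[OF assms(2)] ext[of a "even_elt (a U) (\<lambda>l. a (V l))"]
    by blast
next
  case one
  have "a c = odd_elt (a X) (\<lambda>l. a (Q l)) c" for c
    using assms(1) one by (cases c) (auto simp: homogeneous_def)
  then show ?thesis
    using one finite_on_component(2)[OF assms(2)] ext[of a "odd_elt (a X) (\<lambda>l. a (Q l))"]
    by blast
qed

lemma prod_even_odd:
  "prod (even_elt u v) (even_elt u' v') = even_elt (u * u') (\<lambda>l. u * v' l + u' * v l)"
  "prod (even_elt u v) (odd_elt u' v') = odd_elt (u * u') (\<lambda>l. u * v' l + u' * v l)"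
  "prod (odd_elt u v) (even_elt u' v') = odd_elt (u * u') (\<lambda>l. u * v' l + u' * v l)"
  "prod (odd_elt u v) (odd_elt u' v') = even_elt 0 (br v v')"
proof -
  show "prod (even_elt u v) (even_elt u' v') = even_elt (u * u') (\<lambda>l. u * v' l + u' * v l)"
  proof
    show "prod (even_elt u v) (even_elt u' v') c = even_elt (u * u') (\<lambda>l. u * v' l + u' * v l) c" for c
      by (cases c) (simp_all add: br_zero)
  qed
  show "prod (even_elt u v) (odd_elt u' v') = odd_elt (u * u') (\<lambda>l. u * v' l + u' * v l)"
  proof
    show "prod (even_elt u v) (odd_elt u' v') c = odd_elt (u * u') (\<lambda>l. u * v' l + u' * v l) c" for c
      by (cases c) (simp_all add: br_zero)
  qed
  show "prod (odd_elt u v) (even_elt u' v') = odd_elt (u * u') (\<lambda>l. u * v' l + u' * v l)"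
  proof
    show "prod (odd_elt u v) (even_elt u' v') c = odd_elt (u * u') (\<lambda>l. u * v' l + u' * v l) c" for c
      by (cases c) (simp_all add: br_zero)
  qed
  show "prod (odd_elt u v) (odd_elt u' v') = even_elt 0 (br v v')"
  proof
    show "prod (odd_elt u v) (odd_elt u' v') c = even_elt 0 (br v v') c" for c
      by (cases c) (simp_all add: br_zero)
  qed
qed

lemma prod_supercommutative:
  assumes "homogeneous p a" "finite_on dbasis a" "homogeneous q b" "finite_on dbasis b"
  shows "prod a b c = ksign (p * q) * prod b a c"
proof -
  obtain u v where a: "p = 0 \<and> a = even_elt u v \<or> p = 1 \<and> a = odd_elt u v"
    using homogeneous_cases[OF assms(1,2)] by blast
  obtain u' v' where b: "q = 0 \<and> b = even_elt u' v' \<or> q = 1 \<and> b = odd_elt u' v'"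
    using homogeneous_cases[OF assms(3,4)] by blast
  show ?thesis
    using a b br_antisym[of v v']
    by (elim disjE conjE; cases c) (simp_all add: prod_even_odd ksign_def)
qed

lemma br_br_minus: "br (br f g) h l = - br (br g f) h l"
proof -
  have "br f g = (\<lambda>l. (-1) * br g f l)"
    by (rule ext) (simp add: br_antisym[of f g])
  then show ?thesis
    by (simp only: br_scale) simp
qed

text \<open>
  After expansion by parities, every case but one is a cancellation that uses antisymmetry of the bracket.
  The exception is that of four odd arguments, where the three terms on the right are
  \<open>[[a, b], d]\<close>, \<open>- [[a, d], b]\<close> and \<open>[[b, d], a]\<close> up to the factor \<open>c X\<close>, the coordinate
  of the third argument at \<open>X\<close>; there the Jacobi identity is needed.
\<close>

lemma prod_jordan:
  assumes a: "homogeneous p a" "finite_on dbasis a" and b: "homogeneous q b" "finite_on dbasis b"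
    and c: "homogeneous r c" "finite_on dbasis c" and d: "homogeneous s d" "finite_on dbasis d"
  shows "prod (prod a b) (prod c d) e
       + ksign (q * r) * prod (prod a c) (prod b d) e
       + ksign ((q + r) * s) * prod (prod a d) (prod b c) e
       = prod (prod (prod a b) c) d e
       + ksign (q * (r + s) + r * s) * prod (prod (prod a d) c) b e
       + ksign (p * (q + r + s) + r * s) * prod (prod (prod b d) c) a e"
proof -
  have jac: "br (br f g) h l = br (br f h) g l - br (br g h) f l"
    if "finite_on B f" "finite_on B g" "finite_on B h" for f g h l
    using jacobi[OF that, of l] br_br_minus[of h f g l]
    by (simp add: eq_neg_iff_add_eq_0 algebra_simps)
  note linear = br_zero br_add br_add2 br_scale br_scale2 even_elt.simps odd_elt.simps
  obtain va :: "'l \<Rightarrow> 'k" and ua where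
    a: "p = 0 \<and> a = even_elt ua va \<or> p = 1 \<and> a = odd_elt ua va" and fa: "finite_on B va"
    using homogeneous_cases[OF a] by blast
  obtain vb :: "'l \<Rightarrow> 'k" and ub where
    b: "q = 0 \<and> b = even_elt ub vb \<or> q = 1 \<and> b = odd_elt ub vb" and fb: "finite_on B vb"
    using homogeneous_cases[OF b] by blast
  obtain vc :: "'l \<Rightarrow> 'k" and uc where
    c: "r = 0 \<and> c = even_elt uc vc \<or> r = 1 \<and> c = odd_elt uc vc"
    using homogeneous_cases[OF c] by blast
  obtain vd :: "'l \<Rightarrow> 'k" and ud where
    d: "s = 0 \<and> d = even_elt ud vd \<or> s = 1 \<and> d = odd_elt ud vd" and fd: "finite_on B vd"
    using homogeneous_cases[OF d] by blast
  note antisym = br_antisym[of vb va] br_antisym[of vc va] br_antisym[of vd va] br_antisym[of vc vb]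
    br_antisym[of vd vb] br_antisym[of vd vc]
  show ?thesis
    using a b c d
    apply (elim disjE conjE)
    by (cases e; simp only: prod_even_odd linear;
        simp add: jac[OF fa fb fd] antisym ksign_def algebra_simps)+
qed

lemma direct_sum_coord_space:
  "unital_algebra.direct_sum scale (\<lambda>i. coord_space {b. g b = i} :: (nat \<Rightarrow>\<^sub>0 'k) set)"
  unfolding unital_algebra.direct_sum_def[OF unital_algebra]
  by (intro conjI allI subspace_coord_space coord_space_decomposition)

lemma jordan_superalgebra: "jordan_superalgebra scale (\<odot>) (unit_vec U) part"
proof -
  interpret unital_algebra scale "(\<odot>)" "unit_vec U"
    by (rule unital_algebra)
  have "superalgebra scale (\<odot>) (unit_vec U) part"
  proof (rule superalgebra.intro[OF unital_algebra], rule superalgebra_axioms.intro)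
    show "direct_sum part"
      using direct_sum_coord_space[of parity] by (simp add: part_def[abs_def])
    show "a \<odot> b \<in> part (p + q)" if ab: "a \<in> part p" "b \<in> part q" for a b p q
      unfolding part_iff homogeneous_def coef_mult
    proof (intro allI impI)
      fix c assume "prod (coef a) (coef b) c \<noteq> 0"
      then obtain c1 c2 where "coef a c1 \<noteq> 0" "coef b c2 \<noteq> 0" "parity c = parity c1 + parity c2"
        using prod_graded[OF finite_on_coef finite_on_coef] by blast
      then show "parity c = p + q"
        using ab unfolding part_iff homogeneous_def by simp
    qed
  qed
  then show ?thesis
  proof (rule jordan_superalgebra.intro, intro jordan_superalgebra_axioms.intro)
    show "a \<odot> b = scale (ksign (p * q)) (b \<odot> a)" if ab: "a \<in> part p" "b \<in> part q" for a b p q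
    proof (rule coef_eqI)
      show "coef (a \<odot> b) c = coef (scale (ksign (p * q)) (b \<odot> a)) c" for c
        unfolding coef_scale coef_mult using ab
        by (intro prod_supercommutative finite_on_coef) (simp_all add: part_iff)
    qed
    show "a \<odot> b \<odot> (c \<odot> d) + scale (ksign (q * r)) (a \<odot> c \<odot> (b \<odot> d))
       + scale (ksign ((q + r) * s)) (a \<odot> d \<odot> (b \<odot> c))
       = a \<odot> b \<odot> c \<odot> d + scale (ksign (q * (r + s) + r * s)) (a \<odot> d \<odot> c \<odot> b)
       + scale (ksign (p * (q + r + s) + r * s)) (b \<odot> d \<odot> c \<odot> a)" (is "?l = ?r")
      if abcd: "a \<in> part p" "b \<in> part q" "c \<in> part r" "d \<in> part s" for a b c d p q r s
    proof (rule coef_eqI)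
      show "coef ?l e = coef ?r e" for e
        unfolding coef_scale coef_mult coef_add using abcd
        by (intro prod_jordan finite_on_coef) (simp_all add: part_iff)
    qed
  qed
qed

end

context graded_lie_algebra
begin

definition generators :: "(nat \<Rightarrow>\<^sub>0 'k) set" where
  "generators = {unit_vec X, unit_vec (V x), unit_vec (V y)}"

primrec on_V :: "('l \<Rightarrow> 'k) \<Rightarrow> 'l double \<Rightarrow> 'k" where
  "on_V f U = 0" | "on_V f X = 0" | "on_V f (V l) = f l" | "on_V f (Q l) = 0"

primrec on_Q :: "('l \<Rightarrow> 'k) \<Rightarrow> 'l double \<Rightarrow> 'k" where
  "on_Q f U = 0" | "on_Q f X = 0" | "on_Q f (V l) = 0" | "on_Q f (Q l) = f l"

lemma finite_on_VQ:
  assumes "finite_on B f"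
  shows "finite_on dbasis (on_V f)" "finite_on dbasis (on_Q f)"
proof -
  have fin: "finite {l. f l \<noteq> 0}" and sub: "{l. f l \<noteq> 0} \<subseteq> B"
    using assms by (simp_all add: finite_on_def)
  show "finite_on dbasis (on_V f)"
  proof (rule finite_onI)
    show "finite (V ` {l. f l \<noteq> 0})" "V ` {l. f l \<noteq> 0} \<subseteq> dbasis"
      using fin sub by auto
    show "c \<in> V ` {l. f l \<noteq> 0}" if "on_V f c \<noteq> 0" for c
      using that by (cases c) simp_all
  qed
  show "finite_on dbasis (on_Q f)"
  proof (rule finite_onI)
    show "finite (Q ` {l. f l \<noteq> 0})" "Q ` {l. f l \<noteq> 0} \<subseteq> dbasis"
      using fin sub by auto
    show "c \<in> Q ` {l. f l \<noteq> 0}" if "on_Q f c \<noteq> 0" for c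
      using that by (cases c) simp_all
  qed
qed

lemma coef_VQ:
  assumes "finite_on B f"
  shows "coef (vec (on_V f)) = on_V f" "coef (vec (on_Q f)) = on_Q f"
  by (rule coef_vec finite_on_VQ assms)+

lemma unit_vec_V: "unit_vec (V l) = vec (on_V (unit_at l))"
proof -
  have "(\<lambda>c. if c = V l then 1 else 0) = on_V (unit_at l)"
  proof
    show "(if c = V l then 1 else 0) = on_V (unit_at l) c" for c
      by (cases c) simp_all
  qed
  then show ?thesis by (simp add: unit_vec_def)
qed

lemma unit_vec_Q: "unit_vec (Q l) = vec (on_Q (unit_at l))"
proof -
  have "(\<lambda>c. if c = Q l then 1 else 0) = on_Q (unit_at l)"
  proof
    show "(if c = Q l then 1 else 0) = on_Q (unit_at l) c" for c
      by (cases c) simp_all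
  qed
  then show ?thesis by (simp add: unit_vec_def)
qed

lemma X_mult_V:
  assumes "finite_on B f"
  shows "unit_vec X \<odot> vec (on_V f) = vec (on_Q f)"
proof (rule coef_eqI)
  show "coef (unit_vec X \<odot> vec (on_V f)) c = coef (vec (on_Q f)) c" for c
    by (cases c) (simp_all add: coef_mult coef_VQ[OF assms] coef_unit_vec br_zero)
qed

lemma Q_mult_Q:
  assumes "finite_on B f" "finite_on B g"
  shows "vec (on_Q f) \<odot> vec (on_Q g) = vec (on_V (br f g))"
proof (rule coef_eqI)
  show "coef (vec (on_Q f) \<odot> vec (on_Q g)) c = coef (vec (on_V (br f g))) c" for c
    by (cases c)
      (simp_all add: coef_mult coef_VQ[OF assms(1)] coef_VQ[OF assms(2)] coef_VQ[OF finite_on_br[OF assms]])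
qed

lemma finite_on_unit: "l \<in> B \<Longrightarrow> finite_on B (unit_at l)"
  by (auto simp: finite_on_def)

lemma finite_on_add: "finite_on B f \<Longrightarrow> finite_on B g \<Longrightarrow> finite_on B (\<lambda>l. f l + g l)"
  for f g :: "'l \<Rightarrow> 'k"
  by (rule finite_onI[of "{l. f l \<noteq> 0} \<union> {l. g l \<noteq> 0}"]) (auto simp: finite_on_def)

lemma finite_on_scale: "finite_on B f \<Longrightarrow> finite_on B (\<lambda>l. c * f l)"
  for f :: "'l \<Rightarrow> 'k"
  by (rule finite_onI[of "{l. f l \<noteq> 0}"]) (auto simp: finite_on_def)

text \<open>
  A subalgebra that contains the generators contains \<open>V\<close>-copies of a set of vectors closed under
  the bracket, because \<open>[v, w]\<close> is the product of \<open>X v\<close> and \<open>X w\<close>.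
\<close>

lemma generates: "unital_algebra.generates scale (\<odot>) (unit_vec U) generators"
proof -
  interpret unital_algebra scale "(\<odot>)" "unit_vec U"
    by (rule unital_algebra)
  have "A = UNIV" if A: "unital_subalgebra A" "generators \<subseteq> A" for A
  proof -
    have sub: "subspace A" and one: "unit_vec U \<in> A" and mult: "\<And>a b. a \<in> A \<Longrightarrow> b \<in> A \<Longrightarrow> a \<odot> b \<in> A"
      using A(1) by (auto simp: unital_subalgebra_def)
    have X: "unit_vec X \<in> A"
      using A(2) by (simp add: generators_def)
    have V: "unit_vec (V l) \<in> A" if "l \<in> B" for l
      unfolding unit_vec_V
    proof (rule generated[OF that, where P = "\<lambda>f. vec (on_V f) \<in> A"])
      show "vec (on_V (unit_at x)) \<in> A" "vec (on_V (unit_at y)) \<in> A"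
        using A(2) by (simp_all add: generators_def flip: unit_vec_V)
    next
      fix f g assume fg: "finite_on B f" "finite_on B g" "vec (on_V f) \<in> A" "vec (on_V g) \<in> A"
      have "vec (on_V (\<lambda>l. f l + g l)) = vec (on_V f) + vec (on_V g)"
      proof (rule coef_eqI)
        show "coef (vec (on_V (\<lambda>l. f l + g l))) c = coef (vec (on_V f) + vec (on_V g)) c" for c
          using fg(1,2) by (cases c) (simp_all add: coef_add coef_VQ finite_on_add)
      qed
      with fg sub show "vec (on_V (\<lambda>l. f l + g l)) \<in> A"
        by (simp add: subspace_add)
    next
      fix f k assume f: "finite_on B f" "vec (on_V f) \<in> A"
      have "vec (on_V (\<lambda>l. k * f l)) = scale k (vec (on_V f))"
      proof (rule coef_eqI)
        show "coef (vec (on_V (\<lambda>l. k * f l))) c = coef (scale k (vec (on_V f))) c" for c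
          using f(1) by (cases c) (simp_all add: coef_scale coef_VQ finite_on_scale)
      qed
      with f sub show "vec (on_V (\<lambda>l. k * f l)) \<in> A"
        by (simp add: subspace_scale)
    next
      fix f g assume fg: "finite_on B f" "finite_on B g" "vec (on_V f) \<in> A" "vec (on_V g) \<in> A"
      then show "vec (on_V (br f g)) \<in> A"
        using mult X by (simp flip: X_mult_V Q_mult_Q)
    qed
    have Q: "unit_vec (Q l) \<in> A" if "l \<in> B" for l
      using mult[OF X V[OF that]] unfolding unit_vec_V unit_vec_Q
      by (simp add: X_mult_V finite_on_unit[OF that])
    have "unit_vec b \<in> A" if "b \<in> dbasis" for b
      using that one X V Q by (cases b) simp_all
    then have "coord_space UNIV \<subseteq> A"
      using sub by (intro coord_space_subset) auto
    then show ?thesis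
      by (auto simp: coord_space_def)
  qed
  then show ?thesis
    unfolding generates_def hull_def by blast
qed

lemma card_generators: "card generators = 3"
proof -
  have "(unit_vec b :: nat \<Rightarrow>\<^sub>0 'k) \<noteq> unit_vec c" if "b \<in> dbasis" "c \<in> dbasis" "b \<noteq> c" for b c
  proof
    assume "(unit_vec b :: nat \<Rightarrow>\<^sub>0 'k) = unit_vec c"
    then have "coef (unit_vec b :: nat \<Rightarrow>\<^sub>0 'k) b = coef (unit_vec c) b" by simp
    with that show False by (simp add: coef_unit_vec)
  qed
  then show ?thesis
    using gens by (simp add: generators_def)
qed

lemma monomial_homogeneous:
  assumes "unital_algebra.monomial (\<odot>) (unit_vec U) generators n u"
  shows "u \<in> coord_space {b. ddeg b = n}"
proof -
  interpret unital_algebra scale "(\<odot>)" "unit_vec U"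
    by (rule unital_algebra)
  show ?thesis
    using assms
  proof induction
    case unit
    show ?case by (simp add: coord_space_def coef_unit_vec)
  next
    case (generator u)
    then show ?case
      using gens by (auto simp: generators_def coord_space_def coef_unit_vec split: if_splits)
  next
    case (product m u n v)
    show ?case
      unfolding coord_space_def
    proof (intro CollectI allI impI)
      fix c assume "coef (u \<odot> v) c \<noteq> 0"
      then have "prod (coef u) (coef v) c \<noteq> 0"
        by (simp add: coef_mult)
      then obtain c1 c2 where "coef u c1 \<noteq> 0" "coef v c2 \<noteq> 0" "ddeg c = ddeg c1 + ddeg c2"
        using prod_graded[OF finite_on_coef finite_on_coef] by blast
      with product.IH show "ddeg c = m + n"
        by (simp add: coord_space_def)
    qed
  qed
qed

text \<open>
  Monomials are homogeneous for \<open>ddeg\<close> and span the whole algebra. Projecting an expression of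
  a basis vector by monomials to its own degree discards the monomials of other lengths, so the
  vector is a combination of monomials of the right length.
\<close>

lemma deg_component_eq:
  "unital_algebra.deg_component scale (\<odot>) (unit_vec U) generators n = coord_space {b. ddeg b = n}"
proof -
  interpret unital_algebra scale "(\<odot>)" "unit_vec U"
    by (rule unital_algebra)
  define proj :: "(nat \<Rightarrow>\<^sub>0 'k) \<Rightarrow> (nat \<Rightarrow>\<^sub>0 'k)" where "proj a = vec (\<lambda>b. if ddeg b = n then coef a b else 0)" for a
  have coef_proj: "coef (proj a) b = (if ddeg b = n then coef a b else 0)" for a b
    unfolding proj_def using finite_on_coef[of a]
    by (subst coef_vec) (auto simp: finite_on_def intro: rev_finite_subset)
  have proj_add: "proj (a + b) = proj a + proj b" and proj_scale: "proj (scale k a) = scale k (proj a)"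
    and proj_zero: "proj 0 = 0" for a b k
    by (rule coef_eqI; simp add: coef_proj coef_linear)+
  have "proj a \<in> span {u. monomial generators n u}" for a
  proof -
    obtain m where "a \<in> span (monomials_upto generators m)"
      using generates_imp_span_monomials_upto[OF generates] by blast
    then show ?thesis
    proof (induction rule: span_induct)
      case base
      show ?case
        by (auto simp: subspace_def proj_add proj_scale proj_zero span_zero intro: span_add span_scale)
    next
      case (step u)
      then obtain k where k: "monomial generators k u"
        by (auto simp: monomials_upto_def)
      have u: "coef u b \<noteq> 0 \<Longrightarrow> ddeg b = k" for b
        using monomial_homogeneous[OF k] by (simp add: coord_space_def)
      have "proj u = (if k = n then u else 0)"
        using u by (intro coef_eqI) (auto simp: coef_proj coef_zero)
      with k show ?case by (auto intro: span_base span_zero)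
    qed
  qed
  moreover have "proj a = a" if "a \<in> coord_space {b. ddeg b = n}" for a
    using that by (intro coef_eqI) (auto simp: coef_proj coord_space_def)
  ultimately have "coord_space {b. ddeg b = n} \<subseteq> span {u. monomial generators n u}"
    by (metis subsetI)
  moreover have "span {u. monomial generators n u} \<subseteq> coord_space {b. ddeg b = n}"
    using monomial_homogeneous by (intro span_minimal subspace_coord_space) blast
  ultimately show ?thesis
    unfolding deg_component_def by blast
qed

lemma graded: "unital_algebra.graded_by_degree scale (\<odot>) (unit_vec U) generators"
  unfolding unital_algebra.graded_by_degree_def[OF unital_algebra] deg_component_eq[abs_def]
  by (rule direct_sum_coord_space)

lemma deg_component_triple:
  assumes "n \<ge> 1"
  shows "unital_algebra.deg_component scale (\<odot>) (unit_vec U) generators (3 * n) = {0}"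
proof -
  have ddeg: "ddeg b \<noteq> 3 * n" if "b \<in> dbasis" for b
    using that assms deg_pos by (cases b) (simp; presburger)+
  have "a = 0" if "a \<in> coord_space {b. ddeg b = 3 * n}" for a :: "nat \<Rightarrow>\<^sub>0 'k"
  proof (rule coef_eqI)
    show "coef a b = coef 0 b" for b
      using that ddeg[of b] finite_on_mem[OF finite_on_coef, of a b]
      by (auto simp: coord_space_def coef_zero)
  qed
  then show ?thesis
    unfolding deg_component_eq using subspace_0[OF subspace_coord_space] by blast
qed

lemma ideal_without_unit_eq:
  "unital_algebra.ideal_without_unit scale (\<odot>) (unit_vec U) generators = coord_space (- {U})"
proof -
  interpret unital_algebra scale "(\<odot>)" "unit_vec U"
    by (rule unital_algebra)
  have "span (\<Union>n\<in>{1..}. coord_space {b. ddeg b = n}) \<subseteq> coord_space (- {U})"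
    by (intro span_minimal subspace_coord_space) (fastforce simp: coord_space_def)
  moreover have "coord_space (- {U}) \<subseteq> span (\<Union>n\<in>{1..}. coord_space {b. ddeg b = n})"
  proof (rule coord_space_subset[OF subspace_span])
    fix b assume b: "b \<in> dbasis" "b \<in> - {U}"
    then have "ddeg b \<noteq> 0"
    proof (cases b)
      case (V l)
      with b deg_pos[of l] show ?thesis by simp
    next
      case (Q l)
      with b deg_pos[of l] show ?thesis by simp
    qed simp_all
    then have "ddeg b \<ge> 1"
      by simp
    moreover have "unit_vec b \<in> coord_space {c. ddeg c = ddeg b}"
      using b by (simp add: coord_space_def coef_unit_vec)
    ultimately show "unit_vec b \<in> span (\<Union>n\<in>{1..}. coord_space {b. ddeg b = n})"
      by (intro span_base UN_I[of "ddeg b"]) simp_all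
  qed
  ultimately show ?thesis
    unfolding ideal_without_unit_def deg_component_eq by (rule antisym)
qed

text \<open>
  Each squaring removes a type of basis vectors: first \<open>X\<close>, then the copies \<open>Q l\<close>, then
  everything. The inclusions are strict because \<open>X\<close>, \<open>Q x\<close> and \<open>[x, y] \<noteq> 0\<close> belong to successive terms of
  the derived series but not to the following ones.
\<close>

lemma solvable:
  "unital_algebra.solvable_of_length scale (\<odot>) 3
     (unital_algebra.ideal_without_unit scale (\<odot>) (unit_vec U) generators)"
proof -
  interpret unital_algebra scale "(\<odot>)" "unit_vec U"
    by (rule unital_algebra)
  have square_mono: "square C \<subseteq> square D" if "C \<subseteq> D" for C D
    unfolding square_def using that by (intro span_mono) blast
  have square_coord: "square C \<subseteq> coord_space D"
    if *: "\<And>a b c. a \<in> C \<Longrightarrow> b \<in> C \<Longrightarrow> c \<notin> D \<Longrightarrow> prod (coef a) (coef b) c = 0" for C D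
  proof -
    have "a \<odot> b \<in> coord_space D" if "a \<in> C" "b \<in> C" for a b
    proof -
      have "\<forall>c. prod (coef a) (coef b) c \<noteq> 0 \<longrightarrow> c \<in> D"
        using *[OF that] by blast
      then show ?thesis
        by (simp add: coord_space_def coef_mult)
    qed
    then show ?thesis
      unfolding square_def by (intro span_minimal subspace_coord_space) blast
  qed
  have square_mem: "a \<odot> b \<in> square C" if "a \<in> C" "b \<in> C" for a b C
    unfolding square_def using that by (intro span_base) blast
  define A where "A = (coord_space (- {U}) :: (nat \<Rightarrow>\<^sub>0 'k) set)"
  have coef_A: "coef a U = 0" if "a \<in> A" for a
    using that by (auto simp: A_def coord_space_def)
  have A1: "square A \<subseteq> coord_space (range V \<union> range Q)"
  proof (rule square_coord)
    fix a b and c :: "'l double" assume "a \<in> A" "b \<in> A" "c \<notin> range V \<union> range Q"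
    then show "prod (coef a) (coef b) c = 0"
      using coef_A by (cases c) auto
  qed
  have coef_A1: "coef a U = 0" "coef a X = 0" if "a \<in> square A" for a
    using that A1 by (auto simp: coord_space_def)
  have A2: "square (square A) \<subseteq> coord_space (range V)"
  proof (rule square_coord)
    fix a b and c :: "'l double" assume "a \<in> square A" "b \<in> square A" "c \<notin> range V"
    then show "prod (coef a) (coef b) c = 0"
      using coef_A1 by (cases c) auto
  qed
  have coef_A2: "coef a U = 0" "coef a X = 0" "coef a (Q l) = 0" if "a \<in> square (square A)" for a l
    using that A2 by (auto simp: coord_space_def)
  have "square (square (square A)) \<subseteq> coord_space {}"
  proof (rule square_coord)
    fix a b and c :: "'l double" assume "a \<in> square (square A)" "b \<in> square (square A)"
    then show "prod (coef a) (coef b) c = 0"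
      using coef_A2 by (cases c) (simp_all add: br_zero)
  qed
  also have "coord_space {} = {0 :: nat \<Rightarrow>\<^sub>0 'k}"
    by (auto simp: coord_space_def coef_zero intro: coef_eqI)
  finally have A3: "square (square (square A)) = {0}"
    unfolding square_def using span_zero by blast
  let ?dx = "unit_at x :: 'l \<Rightarrow> 'k" and ?dy = "unit_at y :: 'l \<Rightarrow> 'k"
  have fin: "finite_on B ?dx" "finite_on B ?dy"
    using gens finite_on_unit by simp_all
  have inA: "unit_vec X \<in> A" "unit_vec (V x) \<in> A" "unit_vec (V y) \<in> A"
    using gens by (auto simp: A_def coord_space_def coef_unit_vec)
  have Q_mem: "vec (on_Q ?dx) \<in> square A" "vec (on_Q ?dy) \<in> square A"
    using square_mem[OF inA(1,2)] square_mem[OF inA(1,3)]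
    by (simp_all add: unit_vec_V X_mult_V fin)
  then have V_mem: "vec (on_V (br ?dx ?dy)) \<in> square (square A)"
    using square_mem[OF Q_mem] by (simp add: Q_mult_Q fin)
  have "square A \<subset> A"
  proof
    show "square A \<subseteq> A"
      using A1 by (fastforce simp: A_def coord_space_def)
    have "unit_vec X \<notin> square A"
      using coef_A1(2)[of "unit_vec X"] by (auto simp: coef_unit_vec)
    then show "square A \<noteq> A" using inA by blast
  qed
  moreover have "square (square A) \<subset> square A"
  proof
    show "square (square A) \<subseteq> square A"
      using calculation by (intro square_mono) blast
    have "vec (on_Q ?dx) \<notin> square (square A)"
      using coef_A2(3)[of "vec (on_Q ?dx)" x] by (auto simp: coef_VQ fin)
    then show "square (square A) \<noteq> square A" using Q_mem by blast
  qed
  moreover have "square (square (square A)) \<subset> square (square A)"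
  proof
    show "square (square (square A)) \<subseteq> square (square A)"
      using calculation by (intro square_mono) blast
    obtain l where "br ?dx ?dy l \<noteq> 0"
      using br_gens by blast
    then have "coef (vec (on_V (br ?dx ?dy))) (V l) \<noteq> 0"
      by (simp add: coef_VQ finite_on_br fin)
    then have "vec (on_V (br ?dx ?dy)) \<noteq> 0"
      by (metis coef_zero)
    then show "square (square (square A)) \<noteq> square (square A)" using V_mem A3 by blast
  qed
  ultimately show ?thesis
    unfolding solvable_of_length_def ideal_without_unit_eq A_def[symmetric]
    using A3 by (simp add: numeral_3_eq_3 less_Suc_eq)
qed

lemma growth_eq_card:
  "unital_algebra.growth scale (\<odot>) (unit_vec U) generators n = card {b \<in> dbasis. ddeg b \<le> n}"
proof -
  interpret unital_algebra scale "(\<odot>)" "unit_vec U"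
    by (rule unital_algebra)
  have "span (monomials_upto generators n) = coord_space {b \<in> dbasis. ddeg b \<le> n}"
  proof
    show "span (monomials_upto generators n) \<subseteq> coord_space {b \<in> dbasis. ddeg b \<le> n}"
    proof (intro span_minimal subspace_coord_space subsetI)
      fix u assume "u \<in> monomials_upto generators n"
      then obtain m where "m \<le> n" "monomial generators m u"
        by (auto simp: monomials_upto_def)
      then show "u \<in> coord_space {b \<in> dbasis. ddeg b \<le> n}"
        using monomial_homogeneous[of m u] finite_on_mem[OF finite_on_coef, of u]
        by (auto simp: coord_space_def)
    qed
    show "coord_space {b \<in> dbasis. ddeg b \<le> n} \<subseteq> span (monomials_upto generators n)"
    proof (rule coord_space_subset[OF subspace_span])
      fix b assume b: "b \<in> dbasis" "b \<in> {b \<in> dbasis. ddeg b \<le> n}"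
      then have "unit_vec b \<in> deg_component generators (ddeg b)"
        unfolding deg_component_eq by (simp add: coord_space_def coef_unit_vec)
      also have "\<dots> \<subseteq> span (monomials_upto generators n)"
        unfolding deg_component_def using b by (intro span_mono) (auto simp: monomials_upto_def)
      finally show "unit_vec b \<in> span (monomials_upto generators n)" .
    qed
  qed
  then have "dim (monomials_upto generators n) = dim (coord_space {b \<in> dbasis. ddeg b \<le> n} :: (nat \<Rightarrow>\<^sub>0 'k) set)"
    by (metis dim_span)
  then show ?thesis
    by (simp add: growth_eq dim_coord_space)
qed

lemma growth_bounds:
  shows "unital_algebra.growth scale (\<odot>) (unit_vec U) generators n \<le> 2 + 2 * card {l \<in> B. deg l \<le> n}"
    and "card {l \<in> B. deg l \<le> (n + 2) div 3} \<le> unital_algebra.growth scale (\<odot>) (unit_vec U) generators n"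
proof -
  let ?D = "{b \<in> dbasis. ddeg b \<le> n}" and ?L = "{l \<in> B. deg l \<le> n}"
  have "?D \<subseteq> {U, X} \<union> (V ` ?L \<union> Q ` ?L)"
    using deg_pos by (auto simp: dbasis_def)
  then have "card ?D \<le> card ({U, X} \<union> (V ` ?L \<union> Q ` ?L))"
    using finite_deg_le by (intro card_mono) auto
  also have "\<dots> \<le> card {U, X :: 'l double} + (card (V ` ?L) + card (Q ` ?L))"
    by (intro order_trans[OF card_Un_le] add_mono card_Un_le order_refl)
  also have "\<dots> \<le> 2 + 2 * card ?L"
    using card_image_le[OF finite_deg_le, of V n] card_image_le[OF finite_deg_le, of Q n] by simp
  finally show "unital_algebra.growth scale (\<odot>) (unit_vec U) generators n \<le> 2 + 2 * card ?L"
    by (simp add: growth_eq_card)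
  have "card {l \<in> B. deg l \<le> (n + 2) div 3} = card (V ` {l \<in> B. deg l \<le> (n + 2) div 3})"
    by (simp add: card_image inj_on_def)
  also have "\<dots> \<le> card ?D"
    using finite_ddeg_le by (intro card_mono) auto
  finally show "card {l \<in> B. deg l \<le> (n + 2) div 3}
      \<le> unital_algebra.growth scale (\<odot>) (unit_vec U) generators n"
    by (simp add: growth_eq_card)
qed

text \<open>
  The basis elements of degree at most \<open>n\<close> of the double come from those of the Lie algebra of degree
  about \<open>n / 3\<close>, so the order of growth is that of the Lie algebra.
\<close>

theorem jordan_double:
  assumes "0 < c" "0 \<le> r"
    and lower: "\<And>n. n \<ge> 1 \<Longrightarrow> c * real n powr r \<le> card {l \<in> B. deg l \<le> n}"
    and upper: "\<And>n. n \<ge> 1 \<Longrightarrow> card {l \<in> B. deg l \<le> n} \<le> C * real n powr r"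
  shows "\<exists>(scale :: 'k \<Rightarrow> (nat \<Rightarrow>\<^sub>0 'k) \<Rightarrow> (nat \<Rightarrow>\<^sub>0 'k)) mult one part X.
    jordan_superalgebra scale mult one part \<and>
    card X = 3 \<and> unital_algebra.generates scale mult one X \<and>
    (\<forall>Y. finite Y \<and> unital_algebra.generates scale mult one Y \<longrightarrow>
       unital_algebra.upper_GKdim scale mult one Y = ereal r \<and>
       unital_algebra.lower_GKdim scale mult one Y = ereal r) \<and>
    unital_algebra.graded_by_degree scale mult one X \<and>
    (\<forall>n\<ge>1. unital_algebra.deg_component scale mult one X (3 * n) = {0}) \<and>
    unital_algebra.solvable_of_length scale mult 3
      (unital_algebra.ideal_without_unit scale mult one X)"
proof -
  interpret unital_algebra scale "(\<odot>)" "unit_vec U"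
    by (rule unital_algebra)
  have low: "c * (1 / 3) powr r * real n powr r \<le> growth generators n" if "n \<ge> 1" for n
  proof -
    have "n \<le> 3 * ((n + 2) div 3)"
      by presburger
    then have "real n \<le> real (3 * ((n + 2) div 3))"
      by (simp only: of_nat_le_iff)
    then have "(1 / 3 * real n) powr r \<le> real ((n + 2) div 3) powr r"
      using \<open>0 \<le> r\<close> by (intro powr_mono2) auto
    then have "c * (1 / 3) powr r * real n powr r \<le> c * real ((n + 2) div 3) powr r"
      using \<open>0 < c\<close> by (simp only: mult.assoc flip: powr_mult) simp
    also have "\<dots> \<le> card {l \<in> B. deg l \<le> (n + 2) div 3}"
      using that by (intro lower) presburger
    also have "\<dots> \<le> growth generators n"
      using growth_bounds(2) by simp
    finally show ?thesis .
  qed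
  have up: "growth generators n \<le> (2 + 2 * C) * real n powr r" if "n \<ge> 1" for n
  proof -
    have "1 powr r \<le> real n powr r"
      using that \<open>0 \<le> r\<close> by (intro powr_mono2) auto
    moreover have "real (growth generators n) \<le> 2 + 2 * real (card {l \<in> B. deg l \<le> n})"
      using growth_bounds(1)[of n] by linarith
    ultimately show ?thesis
      using upper[OF that] by (simp add: algebra_simps)
  qed
  have fin: "finite generators"
    by (simp add: generators_def)
  have pos: "0 < c * (1 / 3) powr r"
    using \<open>0 < c\<close> by simp
  have "upper_GKdim Y = ereal r \<and> lower_GKdim Y = ereal r" if "finite Y" "generates Y" for Y
    using GKdim_eq_if_growth_power(1)[OF fin generates that pos \<open>0 \<le> r\<close> low up]
      GKdim_eq_if_growth_power(2)[OF fin generates that pos \<open>0 \<le> r\<close> low up] by (rule conjI)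
  then have "\<forall>Y. finite Y \<and> generates Y \<longrightarrow> upper_GKdim Y = ereal r \<and> lower_GKdim Y = ereal r"
    by simp
  moreover have "\<forall>n\<ge>1. deg_component generators (3 * n) = {0}"
    using deg_component_triple by simp
  ultimately show ?thesis
    by (intro exI[of _ scale] exI[of _ "(\<odot>)"] exI[of _ "unit_vec U"] exI[of _ part]
        exI[of _ generators] conjI jordan_superalgebra card_generators generates graded solvable)
qed

end

section \<open>A differential algebra with one generator\<close>

text \<open>
  The coefficient of \<open>u\<^sup>n\<^sup>-\<^sup>2\<^sup>h q\<^sup>h\<close> in \<open>x\<^sub>1\<^sup>n + x\<^sub>2\<^sup>n\<close>, written as a polynomial in
  \<open>u = x\<^sub>1 + x\<^sub>2\<close> and \<open>q = x\<^sub>1 x\<^sub>2\<close>; the recursion is Newton's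
  \<open>p\<^sub>n\<^sub>+\<^sub>2 = u p\<^sub>n\<^sub>+\<^sub>1 - q p\<^sub>n\<close>.
\<close>

fun power_sum :: "nat \<Rightarrow> nat \<Rightarrow> 'k::field" where
  "power_sum 0 h = (if h = 0 then 2 else 0)"
| "power_sum (Suc 0) h = (if h = 0 then 1 else 0)"
| "power_sum (Suc (Suc n)) h =
    power_sum (Suc n) h - (case h of 0 \<Rightarrow> 0 | Suc h' \<Rightarrow> power_sum n h')"

text \<open>
  The coefficient of \<open>u\<^sup>i\<^sup>+\<^sup>j\<^sup>-\<^sup>2\<^sup>l q\<^sup>l\<close> in \<open>x\<^sub>1\<^sup>i x\<^sub>2\<^sup>j + x\<^sub>1\<^sup>j x\<^sub>2\<^sup>i\<close>, which is a power of
  \<open>q\<close> times a power sum.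
\<close>

definition sym_coef :: "nat \<Rightarrow> nat \<Rightarrow> nat \<Rightarrow> 'k::field" where
  "sym_coef i j l = (if l < min i j then 0 else power_sum (max i j - min i j) (l - min i j))"

lemma power_sum_zero: "n < 2 * h \<Longrightarrow> power_sum n h = 0"
  by (induction n h rule: power_sum.induct) (auto split: nat.split)

lemma sym_coef_commute: "sym_coef i j l = sym_coef j i l"
  by (simp add: sym_coef_def min.commute max.commute)

lemma sym_coef_zero: "i + j < 2 * l \<Longrightarrow> sym_coef i j l = 0"
  unfolding sym_coef_def by (auto intro!: power_sum_zero simp: min_def max_def)

lemma sym_coef_diag: "sym_coef l l l = 2"
  by (simp add: sym_coef_def)

text \<open>
  Multiplication of \<open>x\<^sub>1\<^sup>i x\<^sub>2\<^sup>j + x\<^sub>1\<^sup>j x\<^sub>2\<^sup>i\<close> by \<open>u\<close> leaves the exponent of \<open>q\<close> unchanged. This is the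
  Leibniz rule for \<open>D (t\<^sub>i t\<^sub>j)\<close> in coordinates.
\<close>

lemma sym_coef_Suc: "sym_coef (Suc i) j l + sym_coef i (Suc j) l = (sym_coef i j l :: 'k::field)"
proof -
  have less: "sym_coef (Suc (j + d)) j l + sym_coef (j + d) (Suc j) l = (sym_coef (j + d) j l :: 'k)" for j d
  proof (cases d)
    case 0
    then show ?thesis by (simp add: sym_coef_def)
  next
    case (Suc e)
    have "max (Suc (j + d)) j - min (Suc (j + d)) j = Suc (Suc e)" "min (Suc (j + d)) j = j"
      "max (j + d) (Suc j) - min (j + d) (Suc j) = e" "min (j + d) (Suc j) = Suc j"
      "max (j + d) j - min (j + d) j = Suc e" "min (j + d) j = j"
      using Suc by auto
    then show ?thesis
      by (auto simp: sym_coef_def split: nat.split)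
        (metis Suc_diff_Suc diff_Suc_Suc diff_is_0_eq' le_less_Suc_eq nat.inject not_less old.nat.distinct(2))+
  qed
  show ?thesis
  proof (cases "j \<le> i")
    case True
    then show ?thesis using less[of j "i - j"] by simp
  next
    case False
    then show ?thesis
      using less[of i "j - i"] by (simp add: sym_coef_commute[of _ "Suc j"] sym_coef_commute[of _ j] add.commute)
  qed
qed

text \<open>
  Basis of the second tensor factor: \<open>E\<close> is the unit, \<open>I i\<close> is \<open>t\<^sub>i\<close>, and \<open>W k l\<close> is
  \<open>u\<^sup>k q\<^sup>l\<close>. A basis monomial of \<open>M\<close> is a multiset of indices of variables \<open>y\<^sub>j\<close> together with
  a slot.
\<close>

datatype slot = E | I nat | W nat nat

type_synonym mono = "nat multiset \<times> slot"

text \<open>There are \<open>m\<close> variables \<open>y\<^sub>j\<close>, and \<open>S\<close> is the set of exponents of \<open>q\<close> that are retained.\<close>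

locale module_ops =
  fixes m :: nat and S :: "nat set"
begin

text \<open>
  Operators on coordinate functions are given by the coefficients of the image, so each value is a
  sum over the basis monomials that are mapped to the given one. \<open>tau j\<close> is multiplication by
  \<open>y\<^sub>j\<close> for \<open>j < m\<close>, and by \<open>t\<^sub>j\<^sub>-\<^sub>m\<close> for \<open>j \<ge> m\<close>.
\<close>

definition tau :: "nat \<Rightarrow> (mono \<Rightarrow> 'k::field) \<Rightarrow> mono \<Rightarrow> 'k" where
  "tau j v x = (case x of (\<mu>, z) \<Rightarrow>
     if j < m then (if j \<in># \<mu> then v (\<mu> - {#j#}, z) else 0)
     else (case z of E \<Rightarrow> 0
       | I i \<Rightarrow> if i = j - m then v (\<mu>, E) else 0
       | W k l \<Rightarrow> if l \<in> S \<and> j - m \<le> k + 2 * l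
           then sym_coef (j - m) (k + 2 * l - (j - m)) l * v (\<mu>, I (k + 2 * l - (j - m))) else 0))"

definition slot_shift :: "(mono \<Rightarrow> 'k::field) \<Rightarrow> mono \<Rightarrow> 'k" where
  "slot_shift v x = (case x of (\<mu>, z) \<Rightarrow>
     (case z of E \<Rightarrow> 0
      | I i \<Rightarrow> (case i of 0 \<Rightarrow> 0 | Suc i' \<Rightarrow> v (\<mu>, I i'))
      | W k l \<Rightarrow> (case k of 0 \<Rightarrow> 0 | Suc k' \<Rightarrow> v (\<mu>, W k' l))))"

text \<open>The partial derivative with respect to \<open>y\<^sub>j\<close>.\<close>

definition partial :: "nat \<Rightarrow> (mono \<Rightarrow> 'k::field) \<Rightarrow> mono \<Rightarrow> 'k" where
  "partial j v x = (case x of (\<mu>, z) \<Rightarrow> of_nat (count \<mu> j + 1) * v (add_mset j \<mu>, z))"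

text \<open>
  The derivation \<open>D\<close> as a sum of vector fields: it sends \<open>y\<^sub>j\<close> to \<open>\<tau>\<^sub>j\<^sub>+\<^sub>1\<close>, which is \<open>t\<^sub>0\<close> for
  \<open>j = m - 1\<close>, and shifts the second tensor factor.
\<close>

definition derivation :: "(mono \<Rightarrow> 'k::field) \<Rightarrow> mono \<Rightarrow> 'k" where
  "derivation v x = slot_shift v x + (\<Sum>j<m. tau (Suc j) (partial j v) x)"

lemma tau_linear:
  "tau j (\<lambda>x. v x + w x) = (\<lambda>x. tau j v x + tau j w x)" "tau j (\<lambda>x. c * v x) = (\<lambda>x. c * tau j v x)"
  by (auto simp: tau_def fun_eq_iff algebra_simps split: slot.split)

lemma slot_shift_linear:
  "slot_shift (\<lambda>x. v x + w x) = (\<lambda>x. slot_shift v x + slot_shift w x)"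
  "slot_shift (\<lambda>x. c * v x) = (\<lambda>x. c * slot_shift v x)"
  by (auto simp: slot_shift_def fun_eq_iff algebra_simps split: slot.split nat.split)

lemma partial_linear:
  "partial j (\<lambda>x. v x + w x) = (\<lambda>x. partial j v x + partial j w x)"
  "partial j (\<lambda>x. c * v x) = (\<lambda>x. c * partial j v x)"
  by (auto simp: partial_def fun_eq_iff algebra_simps)

lemma derivation_linear:
  "derivation (\<lambda>x. v x + w x) = (\<lambda>x. derivation v x + derivation w x)"
  "derivation (\<lambda>x. c * v x) = (\<lambda>x. c * derivation v x)"
  by (auto simp: derivation_def fun_eq_iff slot_shift_linear partial_linear tau_linear
      sum.distrib sum_distrib_left algebra_simps)

lemma tau_commute: "tau i (tau j v) = tau j (tau i v)"
proof
  fix x :: mono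
  obtain \<mu> z where x: "x = (\<mu>, z)" by (cases x)
  consider "i < m" "j < m" | "i < m" "\<not> j < m" | "\<not> i < m" "j < m" | "\<not> i < m" "\<not> j < m"
    by blast
  then show "tau i (tau j v) x = tau j (tau i v) x"
  proof cases
    case 1
    show ?thesis
    proof (cases "i = j")
      case False
      have "i \<in># \<mu> \<and> j \<in># \<mu> - {#i#} \<longleftrightarrow> j \<in># \<mu> \<and> i \<in># \<mu> - {#j#}"
        using False by (auto simp: in_diff_count count_greater_zero_iff[symmetric] simp del: count_greater_zero_iff)
      moreover have "\<mu> - {#i#} - {#j#} = \<mu> - {#j#} - {#i#}"
        by (rule diff_right_commute)
      ultimately show ?thesis
        using 1 x by (simp add: tau_def) metis
    qed simp
  next
    case 4
    have "sym_coef (i - m) (j - m) l = sym_coef (j - m) (i - m) l" for l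
      by (rule sym_coef_commute)
    with 4 x show ?thesis
      by (cases z) (auto simp: tau_def)
  qed (cases z; simp add: tau_def x)+
qed

lemma slot_shift_tau:
  "slot_shift (tau j v) x = tau j (slot_shift v) x + (if j < m then 0 else tau (Suc j) v x)"
proof -
  obtain \<mu> z where x: "x = (\<mu>, z)" by (cases x)
  show ?thesis
  proof (cases "j < m")
    case True
    then show ?thesis
      by (auto simp: x tau_def slot_shift_def split: slot.split nat.split)
  next
    case False
    define i where "i = j - m"
    have i: "j - m = i" "Suc j - m = Suc i"
      using False by (auto simp: i_def)
    show ?thesis
    proof (cases z)
      case E
      with False show ?thesis by (simp add: x tau_def slot_shift_def)
    next
      case (I n)
      with False i show ?thesis by (simp add: x tau_def slot_shift_def split: nat.split)
    next
      case (W k l)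
      show ?thesis
      proof (cases "l \<in> S")
        case True
        show ?thesis
        proof (cases "i < k + 2 * l")
          case less: True
          \<comment> \<open>The coordinate at \<open>W k l\<close> involves \<open>t\<^sub>i t\<^sub>n\<close>, its derivative has one more factor \<open>u\<close>.
            For \<open>k = 0\<close> there is nothing to shift, and the coefficient vanishes for degree reasons.\<close>
          then obtain n where n: "k + 2 * l = Suc (i + n)"
            using less_imp_Suc_add by blast
          have "sym_coef (Suc i) n l + sym_coef i (Suc n) l = (sym_coef i n l :: 'a)"
            by (rule sym_coef_Suc)
          moreover have "sym_coef i n l = (0 :: 'a)" if "k = 0"
            using n that by (intro sym_coef_zero) simp
          ultimately show ?thesis
            using False True W n i
            by (cases k) (auto simp: x tau_def slot_shift_def algebra_simps simp flip: distrib_left distrib_right)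
        next
          case ge: False
          then show ?thesis
            using False True W i by (auto simp: x tau_def slot_shift_def split: nat.split)
        qed
      next
        case l: False
        with False W show ?thesis by (auto simp: x tau_def slot_shift_def split: nat.split)
      qed
    qed
  qed
qed

lemma partial_tau:
  assumes "j < m"
  shows "partial j (tau i v) x = tau i (partial j v) x + (if i = j then v x else 0)"
proof -
  obtain \<mu> z where x: "x = (\<mu>, z)" by (cases x)
  consider "i = j" | "i \<noteq> j" "i < m" | "i \<noteq> j" "\<not> i < m" by blast
  then show ?thesis
  proof cases
    case 1
    show ?thesis
    proof (cases "j \<in># \<mu>")
      case True
      then have "count \<mu> j = Suc (count (\<mu> - {#j#}) j)"
        by simp
      with True 1 assms show ?thesis
        by (simp add: x partial_def tau_def algebra_simps)
    next
      case False
      then have "count \<mu> j = 0"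
        by (simp add: not_in_iff)
      with False 1 assms show ?thesis
        by (simp add: x partial_def tau_def)
    qed
  next
    case 2
    then show ?thesis
      by (auto simp: x partial_def tau_def)
  next
    case 3
    then show ?thesis
      by (cases z) (auto simp: x partial_def tau_def)
  qed
qed

text \<open>
  The commutation relation \<open>[s, \<tau>\<^sub>i] = \<tau>\<^sub>i\<^sub>+\<^sub>1\<close>. For \<open>i < m\<close> it comes from the partial
  derivative with respect to \<open>y\<^sub>i\<close>, and for \<open>i \<ge> m\<close> from the shift of the second tensor factor.
\<close>

lemma derivation_tau: "derivation (tau i v) x = tau i (derivation v) x + tau (Suc i) v x"
proof -
  have tau_sum: "tau i (\<lambda>x. \<Sum>j\<in>A. u j x) = (\<lambda>x. \<Sum>j\<in>A. tau i (u j) x)"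
    if "finite A" for A and u :: "nat \<Rightarrow> mono \<Rightarrow> 'a"
    using that
  proof induction
    case empty
    show ?case using tau_linear(2)[of i 0 "\<lambda>_. 0"] by simp
  next
    case (insert a A)
    then show ?case by (simp add: tau_linear(1))
  qed
  have "tau (Suc j) (partial j (tau i v)) x
      = tau i (tau (Suc j) (partial j v)) x + (if j = i then tau (Suc i) v x else 0)" if "j < m" for j
  proof (cases "i = j")
    case True
    have "partial j (tau i v) = (\<lambda>x. tau i (partial j v) x + v x)"
      using partial_tau[OF that, of i v] True by auto
    then show ?thesis
      using True by (simp add: tau_linear(1) tau_commute[of j "Suc j"])
  next
    case False
    have "partial j (tau i v) = tau i (partial j v)"
      using partial_tau[OF that, of i v] False by auto
    then show ?thesis
      using False by (simp add: tau_commute[of i "Suc j"])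
  qed
  then have "(\<Sum>j<m. tau (Suc j) (partial j (tau i v)) x)
      = (\<Sum>j<m. tau i (tau (Suc j) (partial j v)) x) + (if i < m then tau (Suc i) v x else 0)"
    by (simp add: sum.distrib)
  moreover have "tau i (derivation v) x
      = tau i (slot_shift v) x + (\<Sum>j<m. tau i (tau (Suc j) (partial j v)) x)"
    unfolding derivation_def[abs_def] tau_linear(1) by (simp add: tau_sum)
  ultimately show ?thesis
    by (simp add: derivation_def slot_shift_tau)
qed

primrec slot_deg :: "slot \<Rightarrow> nat" where
  "slot_deg E = 0" | "slot_deg (I i) = m + i + 1" | "slot_deg (W k l) = 2 * (m + 1) + k + 2 * l"

definition weight :: "nat multiset \<Rightarrow> nat" where
  "weight \<mu> = (\<Sum>j\<in>#\<mu>. Suc j)"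

text \<open>The unit \<open>e\<close> has degree \<open>1\<close>, so that \<open>\<tau>\<^sub>0 + e\<close> is homogeneous.\<close>

definition mono_deg :: "mono \<Rightarrow> nat" where
  "mono_deg x = 1 + weight (fst x) + slot_deg (snd x)"

definition module_monos :: "mono set" where
  "module_monos = {(\<mu>, z). set_mset \<mu> \<subseteq> {..<m} \<and> (\<forall>k l. z = W k l \<longrightarrow> l \<in> S)}"

lemma tau_graded:
  assumes "tau i v x \<noteq> 0"
  shows "\<exists>x'. v x' \<noteq> 0 \<and> mono_deg x = mono_deg x' + Suc i \<and> (x' \<in> module_monos \<longrightarrow> x \<in> module_monos)"
proof -
  obtain \<mu> z where x: "x = (\<mu>, z)" by (cases x)
  show ?thesis
  proof (cases "i < m")
    case True
    with assms have i: "i \<in># \<mu>" "v (\<mu> - {#i#}, z) \<noteq> 0"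
      by (auto simp: x tau_def split: if_splits)
    then obtain \<nu> where \<nu>: "\<mu> = add_mset i \<nu>"
      by (meson multi_member_split)
    with i True show ?thesis
      by (intro exI[of _ "(\<nu>, z)"]) (auto simp: x mono_deg_def weight_def module_monos_def)
  next
    case False
    show ?thesis
    proof (cases z)
      case E
      with assms False show ?thesis by (simp add: x tau_def)
    next
      case (I n)
      with assms False show ?thesis
        by (intro exI[of _ "(\<mu>, E)"]) (auto simp: x tau_def mono_deg_def module_monos_def split: if_splits)
    next
      case (W k l)
      with assms False show ?thesis
        by (intro exI[of _ "(\<mu>, I (k + 2 * l - (i - m)))"])
          (auto simp: x tau_def mono_deg_def module_monos_def split: if_splits)
    qed
  qed
qed

lemma derivation_graded:
  assumes "derivation v x \<noteq> 0"
  shows "\<exists>x'. v x' \<noteq> 0 \<and> mono_deg x = mono_deg x' + 1 \<and> (x' \<in> module_monos \<longrightarrow> x \<in> module_monos)"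
proof (cases "slot_shift v x = 0")
  case True
  with assms obtain j where j: "j < m" "tau (Suc j) (partial j v) x \<noteq> 0"
    unfolding derivation_def by (metis (no_types, lifting) add.left_neutral lessThan_iff sum.neutral)
  obtain \<mu> z where x': "partial j v (\<mu>, z) \<noteq> 0" "mono_deg x = mono_deg (\<mu>, z) + Suc (Suc j)"
    "(\<mu>, z) \<in> module_monos \<longrightarrow> x \<in> module_monos"
    using tau_graded[OF j(2)] by (metis surj_pair)
  then show ?thesis
    using j(1) by (intro exI[of _ "(add_mset j \<mu>, z)"])
      (auto simp: partial_def mono_deg_def weight_def module_monos_def)
next
  case False
  obtain \<mu> z where x: "x = (\<mu>, z)" by (cases x)
  show ?thesis
  proof (cases z)
    case E
    with False show ?thesis by (simp add: x slot_shift_def)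
  next
    case (I n)
    with False show ?thesis
      by (intro exI[of _ "(\<mu>, I (n - 1))"])
        (auto simp: x slot_shift_def mono_deg_def module_monos_def split: nat.splits)
  next
    case (W k l)
    with False show ?thesis
      by (intro exI[of _ "(\<mu>, W (k - 1) l)"])
        (auto simp: x slot_shift_def mono_deg_def module_monos_def split: nat.splits)
  qed
qed

end

section \<open>A two-generated Lie algebra of prescribed growth\<close>

text \<open>
  \<open>Ls\<close> is \<open>s\<close>, \<open>Lt 0\<close> is \<open>\<tau>\<^sub>0 + e\<close>, and \<open>Lt i\<close> is \<open>\<tau>\<^sub>i\<close> for \<open>i > 0\<close>; the remaining elements are monomials
  of the module.
\<close>

datatype lie_basis = Ls | Lt nat | Lm mono

context module_ops
begin

definition root :: mono where "root = ({#}, E)"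

text \<open>
  The module component of a vector. The monomial \<open>e\<close> is not a basis element of its own but occurs
  in \<open>Lt 0 = \<tau>\<^sub>0 + e\<close>, so its coordinate is the one at \<open>Lt 0\<close>.
\<close>

definition extend :: "(lie_basis \<Rightarrow> 'k) \<Rightarrow> mono \<Rightarrow> 'k::field" where
  "extend f x = (if x = root then f (Lt 0) else f (Lm x))"

text \<open>
  The action of \<open>\<Sum>\<^sub>i \<phi>\<^sub>i \<tau>\<^sub>i\<close>. As \<open>\<tau>\<^sub>i\<close> raises degrees by \<open>i + 1\<close>, only indices below the degree of the
  target contribute, and truncating there keeps the expression linear in \<open>\<phi>\<close> without support conditions.
\<close>

definition act :: "(nat \<Rightarrow> 'k) \<Rightarrow> (mono \<Rightarrow> 'k) \<Rightarrow> mono \<Rightarrow> 'k::field" where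
  "act \<phi> v x = (\<Sum>i<mono_deg x. \<phi> i * tau i v x)"

definition module_part :: "(lie_basis \<Rightarrow> 'k) \<Rightarrow> (lie_basis \<Rightarrow> 'k) \<Rightarrow> mono \<Rightarrow> 'k::field" where
  "module_part f g x = f Ls * derivation (extend g) x - g Ls * derivation (extend f) x
     + act (\<lambda>i. f (Lt i)) (extend g) x - act (\<lambda>i. g (Lt i)) (extend f) x"

text \<open>The bracket of the semidirect product of \<open>\<langle>s, \<tau>\<^sub>0, \<tau>\<^sub>1, ...\<rangle>\<close> with the module, in the basis above.\<close>

primrec lie_br :: "(lie_basis \<Rightarrow> 'k) \<Rightarrow> (lie_basis \<Rightarrow> 'k) \<Rightarrow> lie_basis \<Rightarrow> 'k::field" where
  "lie_br f g Ls = 0"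
| "lie_br f g (Lt n) = (case n of 0 \<Rightarrow> 0 | Suc i \<Rightarrow> f Ls * g (Lt i) - g Ls * f (Lt i))"
| "lie_br f g (Lm x) = module_part f g x"

lemma extend_linear:
  "extend (\<lambda>l. f l + g l) = (\<lambda>x. extend f x + extend g x)"
  "extend (\<lambda>l. c * f l) = (\<lambda>x. c * extend f x)"
  by (auto simp: extend_def)

lemma act_linear:
  "act \<phi> (\<lambda>x. v x + w x) = (\<lambda>x. act \<phi> v x + act \<phi> w x)"
  "act \<phi> (\<lambda>x. c * v x) = (\<lambda>x. c * act \<phi> v x)"
  "act (\<lambda>i. \<phi> i + \<psi> i) v = (\<lambda>x. act \<phi> v x + act \<psi> v x)"
  "act (\<lambda>i. c * \<phi> i) v = (\<lambda>x. c * act \<phi> v x)"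
  by (auto simp: act_def tau_linear sum.distrib sum_distrib_left algebra_simps)

lemma lie_br_add: "lie_br (\<lambda>l. f l + f' l) g = (\<lambda>l. lie_br f g l + lie_br f' g l)"
proof
  show "lie_br (\<lambda>l. f l + f' l) g l = lie_br f g l + lie_br f' g l" for l
    by (cases l) (simp_all add: module_part_def extend_linear derivation_linear act_linear
        algebra_simps split: nat.split)
qed

lemma lie_br_scale: "lie_br (\<lambda>l. c * f l) g = (\<lambda>l. c * lie_br f g l)"
proof
  show "lie_br (\<lambda>l. c * f l) g l = c * lie_br f g l" for l
    by (cases l) (simp_all add: module_part_def extend_linear derivation_linear act_linear
        algebra_simps split: nat.split)
qed

lemma lie_br_antisym: "lie_br f g l = - lie_br g f l"
  by (cases l) (simp_all add: module_part_def split: nat.split)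

lemma derivation_root: "derivation v root = 0"
  by (auto simp: derivation_def slot_shift_def tau_def root_def intro!: sum.neutral)

lemma act_root: "act \<phi> v root = 0"
  by (auto simp: act_def tau_def root_def intro!: sum.neutral)

text \<open>
  Brackets have no component at \<open>\<tau>\<^sub>0\<close> or \<open>e\<close>, so \<open>extend\<close> is compatible with the bracket
  of the semidirect product.
\<close>

lemma extend_lie_br: "extend (lie_br f g) = module_part f g"
  by (auto simp: extend_def module_part_def derivation_root act_root)

lemma tau_eq_0: "mono_deg x \<le> i \<Longrightarrow> tau i v x = 0"
  using tau_graded[of i v x] by (auto simp: mono_deg_def)

lemma act_eq:
  assumes "\<And>i. i \<ge> N \<Longrightarrow> \<phi> i = 0"
  shows "act \<phi> v = (\<lambda>x. \<Sum>i<N. \<phi> i * tau i v x)"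
proof
  fix x
  have "act \<phi> v x = (\<Sum>i<max N (mono_deg x). \<phi> i * tau i v x)"
    unfolding act_def by (rule sum.mono_neutral_left) (auto simp: tau_eq_0)
  also have "\<dots> = (\<Sum>i<N. \<phi> i * tau i v x)"
    by (rule sum.mono_neutral_right) (auto simp: assms)
  finally show "act \<phi> v x = (\<Sum>i<N. \<phi> i * tau i v x)" .
qed

lemma linear_sum:
  fixes F :: "(mono \<Rightarrow> 'k::field) \<Rightarrow> mono \<Rightarrow> 'k"
  assumes "\<And>v w. F (\<lambda>x. v x + w x) = (\<lambda>x. F v x + F w x)" "\<And>c v. F (\<lambda>x. c * v x) = (\<lambda>x. c * F v x)"
  shows "F (\<lambda>x. \<Sum>i<N. c i * u i x) = (\<lambda>x. \<Sum>i<(N::nat). c i * F (u i) x)"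
proof (induction N)
  case 0
  show ?case using assms(2)[of 0 "\<lambda>_. 0"] by simp
next
  case (Suc N)
  then show ?case by (simp add: assms)
qed

definition shift_seq :: "(nat \<Rightarrow> 'k::field) \<Rightarrow> nat \<Rightarrow> 'k" where
  "shift_seq \<phi> n = (case n of 0 \<Rightarrow> 0 | Suc i \<Rightarrow> \<phi> i)"

lemma act_commute:
  assumes "\<And>i. i \<ge> N \<Longrightarrow> \<phi> i = 0" "\<And>i. i \<ge> N \<Longrightarrow> \<psi> i = 0"
  shows "act \<phi> (act \<psi> v) = act \<psi> (act \<phi> v)"
proof
  fix x
  have "act \<phi> (act \<psi> v) x = (\<Sum>i<N. \<Sum>j<N. \<phi> i * (\<psi> j * tau i (tau j v) x))"
    by (simp add: act_eq[OF assms(1)] act_eq[OF assms(2)] linear_sum[of "tau _", OF tau_linear] sum_distrib_left)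
  also have "\<dots> = (\<Sum>j<N. \<Sum>i<N. \<psi> j * (\<phi> i * tau j (tau i v) x))"
    by (subst sum.swap) (simp add: tau_commute mult.left_commute)
  also have "\<dots> = act \<psi> (act \<phi> v) x"
    by (simp add: act_eq[OF assms(1)] act_eq[OF assms(2)] linear_sum[of "tau _", OF tau_linear] sum_distrib_left)
  finally show "act \<phi> (act \<psi> v) x = act \<psi> (act \<phi> v) x" .
qed

lemma derivation_act:
  assumes "\<And>i. i \<ge> N \<Longrightarrow> \<phi> i = 0"
  shows "derivation (act \<phi> v) x = act \<phi> (derivation v) x + act (shift_seq \<phi>) v x"
proof -
  have shift: "i \<ge> Suc N \<Longrightarrow> shift_seq \<phi> i = 0" for i
    by (cases i) (auto simp: shift_seq_def assms)
  have "derivation (act \<phi> v) x = (\<Sum>i<N. \<phi> i * derivation (tau i v) x)"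
    by (simp add: act_eq[OF assms] linear_sum[of derivation, OF derivation_linear])
  also have "\<dots> = (\<Sum>i<N. \<phi> i * tau i (derivation v) x) + (\<Sum>i<N. \<phi> i * tau (Suc i) v x)"
    by (simp add: derivation_tau distrib_left sum.distrib)
  also have "(\<Sum>i<N. \<phi> i * tau (Suc i) v x) = (\<Sum>i<Suc N. shift_seq \<phi> i * tau i v x)"
    unfolding sum.lessThan_Suc_shift by (simp add: shift_seq_def)
  finally show ?thesis
    by (simp only: act_eq[OF assms] act_eq[OF shift])
qed

text \<open>
  In a semidirect product with an abelian ideal the Jacobi identity says that the operators form a
  representation, that is, \<open>[s, \<tau>\<^sub>i] = \<tau>\<^sub>i\<^sub>+\<^sub>1\<close> and \<open>[\<tau>\<^sub>i, \<tau>\<^sub>j] = 0\<close> on the module.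
\<close>

lemma lie_br_jacobi:
  assumes "\<And>i. i \<ge> N \<Longrightarrow> f (Lt i) = 0" "\<And>i. i \<ge> N \<Longrightarrow> g (Lt i) = 0" "\<And>i. i \<ge> N \<Longrightarrow> h (Lt i) = 0"
  shows "lie_br (lie_br f g) h l + lie_br (lie_br g h) f l + lie_br (lie_br h f) g l = 0"
proof (cases l)
  case Ls
  then show ?thesis by simp
next
  case (Lt n)
  then show ?thesis
    by (auto simp: algebra_simps split: nat.split)
next
  case (Lm x)
  have t: "(\<lambda>i. lie_br f g (Lt i)) = (\<lambda>i. f Ls * shift_seq (\<lambda>i. g (Lt i)) i + (- g Ls) * shift_seq (\<lambda>i. f (Lt i)) i)"
    for f g :: "lie_basis \<Rightarrow> 'a"
    by (auto simp: shift_seq_def split: nat.split)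
  have module_eq: "module_part f g = (\<lambda>x. f Ls * derivation (extend g) x + (- g Ls) * derivation (extend f) x
     + act (\<lambda>i. f (Lt i)) (extend g) x + (-1) * act (\<lambda>i. g (Lt i)) (extend f) x)"
    for f g :: "lie_basis \<Rightarrow> 'a"
    by (auto simp: module_part_def)
  have part: "module_part (lie_br f g) h x =
      - h Ls * (f Ls * derivation (derivation (extend g)) x - g Ls * derivation (derivation (extend f)) x
        + act (\<lambda>i. f (Lt i)) (derivation (extend g)) x + act (shift_seq (\<lambda>i. f (Lt i))) (extend g) x
        - act (\<lambda>i. g (Lt i)) (derivation (extend f)) x - act (shift_seq (\<lambda>i. g (Lt i))) (extend f) x)
      + f Ls * act (shift_seq (\<lambda>i. g (Lt i))) (extend h) x - g Ls * act (shift_seq (\<lambda>i. f (Lt i))) (extend h) x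
      - (f Ls * act (\<lambda>i. h (Lt i)) (derivation (extend g)) x - g Ls * act (\<lambda>i. h (Lt i)) (derivation (extend f)) x
        + act (\<lambda>i. h (Lt i)) (act (\<lambda>i. f (Lt i)) (extend g)) x
        - act (\<lambda>i. h (Lt i)) (act (\<lambda>i. g (Lt i)) (extend f)) x)"
    if "\<And>i. i \<ge> N \<Longrightarrow> f (Lt i) = 0" "\<And>i. i \<ge> N \<Longrightarrow> g (Lt i) = 0" for f g h :: "lie_basis \<Rightarrow> 'a"
  proof -
    have "module_part (lie_br f g) h x = - h Ls * derivation (module_part f g) x
      + act (\<lambda>i. lie_br f g (Lt i)) (extend h) x - act (\<lambda>i. h (Lt i)) (module_part f g) x"
      by (simp only: module_part_def[of "lie_br f g" h] extend_lie_br lie_br.simps(1)) simp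
    also have "derivation (module_part f g) x = f Ls * derivation (derivation (extend g)) x
        - g Ls * derivation (derivation (extend f)) x
        + act (\<lambda>i. f (Lt i)) (derivation (extend g)) x + act (shift_seq (\<lambda>i. f (Lt i))) (extend g) x
        - act (\<lambda>i. g (Lt i)) (derivation (extend f)) x - act (shift_seq (\<lambda>i. g (Lt i))) (extend f) x"
      using derivation_act[of N "\<lambda>i. f (Lt i)" "extend g" x] derivation_act[of N "\<lambda>i. g (Lt i)" "extend f" x] that
      by (simp only: module_eq derivation_linear) simp
    also have "act (\<lambda>i. lie_br f g (Lt i)) (extend h) x =
        f Ls * act (shift_seq (\<lambda>i. g (Lt i))) (extend h) x - g Ls * act (shift_seq (\<lambda>i. f (Lt i))) (extend h) x"
      by (simp only: t act_linear) simp
    also have "act (\<lambda>i. h (Lt i)) (module_part f g) x =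
        f Ls * act (\<lambda>i. h (Lt i)) (derivation (extend g)) x - g Ls * act (\<lambda>i. h (Lt i)) (derivation (extend f)) x
        + act (\<lambda>i. h (Lt i)) (act (\<lambda>i. f (Lt i)) (extend g)) x
        - act (\<lambda>i. h (Lt i)) (act (\<lambda>i. g (Lt i)) (extend f)) x"
      by (simp only: module_eq act_linear) simp
    finally show ?thesis by (simp only: add_diff_eq)
  qed
  show ?thesis
    using act_commute[of N "\<lambda>i. f (Lt i)" "\<lambda>i. g (Lt i)", OF assms(1,2)]
      act_commute[of N "\<lambda>i. g (Lt i)" "\<lambda>i. h (Lt i)", OF assms(2,3)]
      act_commute[of N "\<lambda>i. f (Lt i)" "\<lambda>i. h (Lt i)", OF assms(1,3)]
    by (simp add: Lm part[of f g h, OF assms(1,2)] part[of g h f, OF assms(2,3)]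
        part[of h f g, OF assms(3,1)] algebra_simps)
qed

text \<open>
  The monomials in the ideal generated by \<open>\<tau>\<^sub>1, \<tau>\<^sub>2, ...\<close>. What is left out are the powers of \<open>y\<^sub>0\<close>
  and, if there are no variables \<open>y\<^sub>j\<close>, the element \<open>t\<^sub>0 = \<tau>\<^sub>0\<close>. Then \<open>t\<^sub>0\<^sup>2\<close> is also outside of the
  ideal, which is the reason for requiring \<open>0 \<notin> S\<close> below.
\<close>

definition allowed :: "mono set" where
  "allowed = {(\<mu>, z). (\<mu>, z) \<in> module_monos \<and>
     (case z of E \<Rightarrow> \<not> set_mset \<mu> \<subseteq> {0} | I i \<Rightarrow> 0 < m + i | W k l \<Rightarrow> True)}"

definition lie_indices :: "lie_basis set" where
  "lie_indices = {Ls} \<union> range Lt \<union> Lm ` allowed"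

primrec lie_deg :: "lie_basis \<Rightarrow> nat" where
  "lie_deg Ls = 1" | "lie_deg (Lt i) = Suc i" | "lie_deg (Lm x) = mono_deg x"

lemma lie_indices_simps [simp]:
  "Ls \<in> lie_indices" "Lt i \<in> lie_indices" "Lm x \<in> lie_indices \<longleftrightarrow> x \<in> allowed"
  by (auto simp: lie_indices_def)

lemma root_monos: "root \<in> module_monos"
  by (simp add: root_def module_monos_def)

lemma extend_supp:
  assumes "\<And>l. f l \<noteq> 0 \<Longrightarrow> l \<in> lie_indices" "extend f x \<noteq> 0"
  shows "x \<in> module_monos \<and> (\<exists>l. f l \<noteq> 0 \<and> lie_deg l = mono_deg x)"
proof (cases "x = root")
  case True
  then show ?thesis
    using assms(2) root_monos
    by (intro conjI exI[of _ "Lt 0"]) (auto simp: extend_def root_def mono_deg_def weight_def)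
next
  case False
  then have "f (Lm x) \<noteq> 0"
    using assms(2) by (simp add: extend_def)
  then show ?thesis
    using assms(1)[of "Lm x"] by (intro conjI exI[of _ "Lm x"]) (auto simp: allowed_def)
qed

text \<open>
  The span of the basis is closed under the bracket. A forbidden monomial arises from lower
  monomials through \<open>\<tau>\<^sub>0\<close> only, and these are again forbidden or equal to \<open>e\<close>. In the
  latter case the two contributions of \<open>[\<tau>\<^sub>0 + e, \<tau>\<^sub>0 + e]\<close> cancel.
\<close>

lemma module_part_forbidden:
  assumes f: "\<And>l. f l \<noteq> 0 \<Longrightarrow> l \<in> lie_indices" and g: "\<And>l. g l \<noteq> 0 \<Longrightarrow> l \<in> lie_indices"
    and x: "x \<in> module_monos" "x \<notin> allowed"
  shows "module_part f g x = 0"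
proof -
  obtain \<mu> z where xz: "x = (\<mu>, z)" by (cases x)
  have pos: "0 < mono_deg x"
    by (simp add: mono_deg_def)
  consider "z = E" "set_mset \<mu> \<subseteq> {0}" | "m = 0" "z = I 0" "\<mu> = {#}"
    using x by (cases z) (auto simp: xz allowed_def module_monos_def)
  then show ?thesis
  proof cases
    case 1
    have der: "derivation v x = 0" for v :: "mono \<Rightarrow> 'a"
      using 1 by (auto simp: derivation_def slot_shift_def tau_def xz intro!: sum.neutral)
    show ?thesis
    proof (cases "0 \<in># \<mu> \<and> 0 < m")
      case False
      then have "tau i v x = 0" for i and v :: "mono \<Rightarrow> 'a"
        using 1 by (auto simp: tau_def xz)
      then show ?thesis
        by (simp add: module_part_def der act_def)
    next
      case True
      have act: "act \<phi> v x = \<phi> 0 * v (\<mu> - {#0#}, E)" for \<phi> and v :: "mono \<Rightarrow> 'a"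
      proof -
        have "act \<phi> v x = (\<Sum>i<mono_deg x. if i = 0 then \<phi> 0 * v (\<mu> - {#0#}, E) else 0)"
          unfolding act_def using 1 True by (intro sum.cong) (auto simp: tau_def xz)
        then show ?thesis using pos by simp
      qed
      have "set_mset (\<mu> - {#0#}) \<subseteq> {0}"
        using 1(2) in_diffD by fastforce
      then have "(\<mu> - {#0#}, E) \<notin> allowed"
        by (simp add: allowed_def)
      then have "f (Lm (\<mu> - {#0#}, E)) = 0" "g (Lm (\<mu> - {#0#}, E)) = 0"
        using f g by force+
      then show ?thesis
        by (simp add: module_part_def der act extend_def)
    qed
  next
    case 2
    have der: "derivation v x = 0" for v :: "mono \<Rightarrow> 'a"
    proof -
      have "{..<m} = {}"
        using 2(1) by simp
      then show ?thesis
        using 2(2) by (simp add: derivation_def slot_shift_def xz)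
    qed
    have m: "\<not> i < m" "i - m = i" for i
      using 2(1) by simp_all
    have "act \<phi> v x = \<phi> 0 * v root" for \<phi> and v :: "mono \<Rightarrow> 'a"
    proof -
      have "act \<phi> v x = (\<Sum>i<mono_deg x. if i = 0 then \<phi> 0 * v root else 0)"
        unfolding act_def using 2(2,3) m by (intro sum.cong) (auto simp: tau_def xz root_def)
      then show ?thesis using pos by simp
    qed
    then show ?thesis
      by (simp add: module_part_def der extend_def)
  qed
qed

lemma lie_br_graded:
  assumes f: "\<And>l. f l \<noteq> 0 \<Longrightarrow> l \<in> lie_indices" and g: "\<And>l. g l \<noteq> 0 \<Longrightarrow> l \<in> lie_indices"
    and nz: "lie_br f g l \<noteq> 0"
  shows "l \<in> lie_indices \<and> (\<exists>l1 l2. f l1 \<noteq> 0 \<and> g l2 \<noteq> 0 \<and> lie_deg l = lie_deg l1 + lie_deg l2)"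
proof -
  have half: "x \<in> module_monos \<and> (\<exists>l1 l2. f l1 \<noteq> 0 \<and> g l2 \<noteq> 0 \<and> mono_deg x = lie_deg l1 + lie_deg l2)"
    if g: "\<And>l. g l \<noteq> 0 \<Longrightarrow> l \<in> lie_indices"
      and nz: "f Ls * derivation (extend g) x + act (\<lambda>i. f (Lt i)) (extend g) x \<noteq> 0"
    for f g :: "lie_basis \<Rightarrow> 'a" and x
  proof (cases "f Ls * derivation (extend g) x = 0")
    case False
    then obtain x' where x': "extend g x' \<noteq> 0" "mono_deg x = mono_deg x' + 1" "x' \<in> module_monos \<longrightarrow> x \<in> module_monos"
      using derivation_graded[of "extend g" x] by auto
    then show ?thesis
    proof -
      obtain l where "x' \<in> module_monos" "g l \<noteq> 0" "lie_deg l = mono_deg x'"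
        using extend_supp[OF g x'(1)] by blast
      with x' False show ?thesis
        by (intro conjI exI[of _ Ls] exI[of _ l]) simp_all
    qed
  next
    case True
    with nz have "act (\<lambda>i. f (Lt i)) (extend g) x \<noteq> 0"
      by (metis add_0_left)
    then have "(\<Sum>i<mono_deg x. f (Lt i) * tau i (extend g) x) \<noteq> 0"
      unfolding act_def .
    then have "\<exists>i. f (Lt i) * tau i (extend g) x \<noteq> 0"
      by (rule contrapos_np) (simp add: sum.neutral)
    then obtain i where i: "f (Lt i) * tau i (extend g) x \<noteq> 0" ..
    then obtain x' where x': "extend g x' \<noteq> 0" "mono_deg x = mono_deg x' + Suc i" "x' \<in> module_monos \<longrightarrow> x \<in> module_monos"
      using tau_graded[of i "extend g" x] by auto
    then show ?thesis
    proof -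
      obtain l where "x' \<in> module_monos" "g l \<noteq> 0" "lie_deg l = mono_deg x'"
        using extend_supp[OF g x'(1)] by blast
      with x' i show ?thesis
        by (intro conjI exI[of _ "Lt i"] exI[of _ l]) simp_all
    qed
  qed
  show ?thesis
  proof (cases l)
    case Ls
    with nz show ?thesis by simp
  next
    case (Lt n)
    with nz obtain i where i: "n = Suc i" "f Ls * g (Lt i) - g Ls * f (Lt i) \<noteq> 0"
      by (auto split: nat.splits)
    then consider "f Ls \<noteq> 0" "g (Lt i) \<noteq> 0" | "g Ls \<noteq> 0" "f (Lt i) \<noteq> 0"
      by (cases "f Ls * g (Lt i) = 0") auto
    then show ?thesis
    proof cases
      case 1
      then show ?thesis using Lt i by (intro conjI exI[of _ Ls] exI[of _ "Lt i"]) simp_all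
    next
      case 2
      then show ?thesis using Lt i by (intro conjI exI[of _ "Lt i"] exI[of _ Ls]) simp_all
    qed
  next
    case (Lm x)
    with nz have nz': "module_part f g x \<noteq> 0" by simp
    let ?A = "f Ls * derivation (extend g) x + act (\<lambda>i. f (Lt i)) (extend g) x"
    let ?B = "g Ls * derivation (extend f) x + act (\<lambda>i. g (Lt i)) (extend f) x"
    have "module_part f g x = ?A - ?B"
      by (simp add: module_part_def)
    then have B: "?B \<noteq> 0" if "?A = 0"
      using nz' that by (metis diff_self)
    have "x \<in> module_monos \<and> (\<exists>l1 l2. f l1 \<noteq> 0 \<and> g l2 \<noteq> 0 \<and> mono_deg x = lie_deg l1 + lie_deg l2)"
    proof (cases "?A = 0")
      case False
      show ?thesis by (rule half[OF g False])
    next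
      case True
      obtain l1 l2 where "x \<in> module_monos" "g l1 \<noteq> 0" "f l2 \<noteq> 0" "mono_deg x = lie_deg l1 + lie_deg l2"
        using half[OF f B[OF True]] by blast
      then show ?thesis
        by (intro conjI exI[of _ l2] exI[of _ l1]) simp_all
    qed
    moreover have "x \<in> allowed"
      using module_part_forbidden[of f g x, OF f g] nz' calculation by auto
    ultimately show ?thesis
      using Lm by simp
  qed
qed

end

context module_ops
begin

definition on_module :: "(mono \<Rightarrow> 'k::zero) \<Rightarrow> lie_basis \<Rightarrow> 'k" where
  "on_module v l = (case l of Lm x \<Rightarrow> v x | _ \<Rightarrow> 0)"

lemma on_module_unit: "on_module (unit_at x) = unit_at (Lm x)"
  by (auto simp: on_module_def fun_eq_iff split: lie_basis.split)

lemma extend_unit: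
  "extend (unit_at Ls) = (\<lambda>_. 0)" "extend (unit_at (Lt 0)) = unit_at root"
  "extend (unit_at (Lt (Suc i))) = (\<lambda>_. 0)" "x \<noteq> root \<Longrightarrow> extend (unit_at (Lm x)) = unit_at x"
  by (auto simp: extend_def fun_eq_iff)

lemma ops_zero: "derivation (\<lambda>_. 0) = (\<lambda>_. 0)" "tau i (\<lambda>_. 0) = (\<lambda>_. 0)"
  "act \<phi> (\<lambda>_. 0) = (\<lambda>_. 0)" "act (\<lambda>_. 0) v = (\<lambda>_. 0)"
proof -
  show "derivation (\<lambda>_. 0) = (\<lambda>_. 0)"
    using derivation_linear(2)[of 0 "\<lambda>_. 0"] by simp
  show tau: "tau i (\<lambda>_. 0) = (\<lambda>_. 0)" for i
    using tau_linear(2)[of i 0 "\<lambda>_. 0"] by simp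
  show "act \<phi> (\<lambda>_. 0) = (\<lambda>_. 0)" "act (\<lambda>_. 0) v = (\<lambda>_. 0)"
    by (simp_all add: act_def[abs_def] tau)
qed

lemma act_unit: "act (unit_at i) v = tau i v"
proof
  fix x
  have "act (unit_at i) v x = (\<Sum>j<Suc i. unit_at i j * tau j v x)"
    by (subst act_eq[of "Suc i"]) auto
  also have "\<dots> = (\<Sum>j<Suc i. if j = i then tau i v x else 0)"
    by (intro sum.cong) auto
  finally show "act (unit_at i) v x = tau i v x"
    by simp
qed

lemma tau_unit: "i < m \<Longrightarrow> tau i (unit_at (\<mu>, z)) = unit_at (add_mset i \<mu>, z)"
  by (auto simp: tau_def fun_eq_iff insert_DiffM dest!: multi_member_split)

lemma tau_root: "m \<le> i \<Longrightarrow> tau i (unit_at root) = unit_at ({#}, I (i - m))"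
  by (auto simp: tau_def fun_eq_iff root_def split: slot.split)

lemma derivation_unit:
  "derivation (unit_at ({#}, z)) = slot_shift (unit_at ({#}, z) :: mono \<Rightarrow> 'k::field)"
proof -
  have "partial j (unit_at ({#}, z) :: mono \<Rightarrow> 'k) = (\<lambda>_. 0)" for j
    by (auto simp: partial_def fun_eq_iff)
  then show ?thesis
    by (simp add: derivation_def[abs_def] ops_zero)
qed

lemma slot_shift_root: "slot_shift (unit_at root) = (\<lambda>_. 0)"
  by (auto simp: slot_shift_def root_def fun_eq_iff split: slot.split nat.split)

lemma slot_shift_W: "slot_shift (unit_at (\<mu>, W k l)) = unit_at (\<mu>, W (Suc k) l)"
  by (auto simp: slot_shift_def fun_eq_iff split: slot.split nat.split)

lemma lie_br_unit:
  "lie_br (unit_at Ls) (unit_at (Lt i)) = (unit_at (Lt (Suc i)) :: lie_basis \<Rightarrow> 'k::field)"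
  "lie_br (unit_at (Lt (Suc i))) (unit_at (Lt 0)) = (on_module (tau (Suc i) (unit_at root)) :: lie_basis \<Rightarrow> 'k)"
  "x \<noteq> root \<Longrightarrow> lie_br (unit_at (Lt i)) (unit_at (Lm x)) = (on_module (tau i (unit_at x)) :: lie_basis \<Rightarrow> 'k)"
  "x \<noteq> root \<Longrightarrow> lie_br (unit_at Ls) (unit_at (Lm x)) = (on_module (derivation (unit_at x)) :: lie_basis \<Rightarrow> 'k)"
proof -
  have root: "derivation (unit_at root :: mono \<Rightarrow> 'k) = (\<lambda>_. 0)"
    by (simp add: root_def derivation_unit slot_shift_root[unfolded root_def])
  have Lt: "(\<lambda>j. if Lt j = Lt i then 1 else 0) = (unit_at i :: nat \<Rightarrow> 'k)" for i
    by auto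
  show "lie_br (unit_at Ls) (unit_at (Lt i)) = (unit_at (Lt (Suc i)) :: lie_basis \<Rightarrow> 'k)"
  proof
    fix l
    have ext: "extend (unit_at (Lt i)) = (if i = 0 then unit_at root else (\<lambda>_. 0) :: mono \<Rightarrow> 'k)"
      by (cases i) (simp_all add: extend_unit)
    show "lie_br (unit_at Ls) (unit_at (Lt i)) l = (unit_at (Lt (Suc i)) l :: 'k)"
      by (cases l) (simp_all add: module_part_def ext extend_unit(1) ops_zero root split: nat.split)
  qed
  show "lie_br (unit_at (Lt (Suc i))) (unit_at (Lt 0)) = (on_module (tau (Suc i) (unit_at root)) :: lie_basis \<Rightarrow> 'k)"
  proof
    show "lie_br (unit_at (Lt (Suc i))) (unit_at (Lt 0)) l = (on_module (tau (Suc i) (unit_at root)) l :: 'k)" for l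
      by (cases l) (auto simp: module_part_def extend_unit ops_zero on_module_def Lt[simplified] act_unit split: nat.split)
  qed
  show "lie_br (unit_at (Lt i)) (unit_at (Lm x)) = (on_module (tau i (unit_at x)) :: lie_basis \<Rightarrow> 'k)" if "x \<noteq> root"
  proof
    show "lie_br (unit_at (Lt i)) (unit_at (Lm x)) l = (on_module (tau i (unit_at x)) l :: 'k)" for l
      by (cases l) (auto simp: module_part_def extend_unit that ops_zero on_module_def Lt[simplified] act_unit split: nat.split)
  qed
  show "lie_br (unit_at Ls) (unit_at (Lm x)) = (on_module (derivation (unit_at x)) :: lie_basis \<Rightarrow> 'k)" if "x \<noteq> root"
  proof
    show "lie_br (unit_at Ls) (unit_at (Lm x)) l = (on_module (derivation (unit_at x)) l :: 'k)" for l
      by (cases l) (auto simp: module_part_def extend_unit that ops_zero on_module_def split: nat.split)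
  qed
qed

text \<open>
  The expansion of \<open>t\<^sub>l\<^sup>2\<close>: twice \<open>q\<^sup>l\<close>, plus lower powers of \<open>q\<close> multiplied by powers of \<open>u\<close>. This
  triangular shape makes it possible to reach \<open>q\<^sup>l\<close> by induction on \<open>l\<close>.
\<close>

lemma tau_I_diag:
  assumes "l \<in> S"
  shows "tau (m + l) (unit_at ({#}, I l) :: mono \<Rightarrow> 'k::field) =
    (\<lambda>x. 2 * unit_at ({#}, W 0 l) x
      + (\<Sum>l'\<in>S \<inter> {..<l}. sym_coef l l l' * unit_at ({#}, W (2 * l - 2 * l') l') x))"
proof
  fix x :: mono
  obtain \<mu> z where x: "x = (\<mu>, z)" by (cases x)
  show "tau (m + l) (unit_at ({#}, I l) :: mono \<Rightarrow> 'k) x = 2 * unit_at ({#}, W 0 l) x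
      + (\<Sum>l'\<in>S \<inter> {..<l}. sym_coef l l l' * unit_at ({#}, W (2 * l - 2 * l') l') x)"
  proof (cases "\<exists>k n. z = W k n \<and> \<mu> = {#}")
    case False
    then show ?thesis
      by (auto simp: x tau_def intro!: sum.neutral split: slot.split)
  next
    case True
    then obtain k n where z: "z = W k n" "\<mu> = {#}" by blast
    have tau: "tau (m + l) (unit_at ({#}, I l) :: mono \<Rightarrow> 'k) x = (if n \<in> S \<and> k + 2 * n = 2 * l then sym_coef l l n else 0)"
      by (auto simp: x z tau_def)
    have "(\<Sum>l'\<in>S \<inter> {..<l}. sym_coef l l l' * unit_at ({#}, W (2 * l - 2 * l') l') x)
        = (\<Sum>l'\<in>S \<inter> {..<l}. if l' = n then (if k = 2 * l - 2 * n then sym_coef l l n else 0) else (0 :: 'k))"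
      by (intro sum.cong) (auto simp: x z)
    also have "\<dots> = (if n \<in> S \<and> n < l \<and> k = 2 * l - 2 * n then sym_coef l l n else 0)"
      by simp
    finally show ?thesis
      using assms unfolding tau by (auto simp: x z sym_coef_diag)
  qed
qed

text \<open>
  Bracketing with \<open>s\<close> produces all \<open>\<tau>\<^sub>i\<close> from \<open>b\<close>, and \<open>[\<tau>\<^sub>i, b] = \<tau>\<^sub>i e\<close> for \<open>i > 0\<close>. Multiplication by the
  \<open>y\<^sub>j\<close> is also a bracket, so only monomials without variables \<open>y\<^sub>j\<close> matter. Among these, \<open>t\<^sub>l\<^sup>2\<close>
  gives \<open>q\<^sup>l\<close> after division by \<open>2\<close>, and \<open>s\<close> multiplies by \<open>u\<close>.
\<close>

lemma lie_generated:
  fixes P :: "(lie_basis \<Rightarrow> 'k::field) \<Rightarrow> bool"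
  assumes two: "(2 :: 'k) \<noteq> 0" and S: "0 \<notin> S" and l: "l \<in> lie_indices"
    and x: "P (unit_at Ls)" and y: "P (unit_at (Lt 0))"
    and add: "\<And>f g. finite_on lie_indices f \<Longrightarrow> finite_on lie_indices g \<Longrightarrow> P f \<Longrightarrow> P g \<Longrightarrow> P (\<lambda>l. f l + g l)"
    and scale: "\<And>f c. finite_on lie_indices f \<Longrightarrow> P f \<Longrightarrow> P (\<lambda>l. c * f l)"
    and br: "\<And>f g. finite_on lie_indices f \<Longrightarrow> finite_on lie_indices g \<Longrightarrow> P f \<Longrightarrow> P g \<Longrightarrow> P (lie_br f g)"
  shows "P (unit_at l)"
proof -
  have fin: "finite_on lie_indices (unit_at l :: lie_basis \<Rightarrow> 'k)" if "l \<in> lie_indices" for l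
    using that by (auto simp: finite_on_def)
  have br_unit: "P (lie_br (unit_at l) (unit_at l'))"
    if "l \<in> lie_indices" "l' \<in> lie_indices" "P (unit_at l)" "P (unit_at l')" for l l'
    using br[OF fin fin] that by blast
  have t: "P (unit_at (Lt i))" for i
  proof (induction i)
    case (Suc i)
    then show ?case
      using br_unit[of Ls "Lt i"] x by (simp add: lie_br_unit)
  qed (rule y)
  have not_root: "x \<in> allowed \<Longrightarrow> x \<noteq> root" for x
    by (auto simp: allowed_def root_def)
  have t_mult: "P (on_module (tau i (unit_at x)))" if "x \<in> allowed" "P (unit_at (Lm x))" for x i
    using br_unit[of "Lt i" "Lm x"] t that not_root by (simp add: lie_br_unit)
  have t_root: "P (on_module (tau i (unit_at root)))" if "0 < i" for i
  proof -
    obtain i' where i': "i = Suc i'"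
      using \<open>0 < i\<close> gr0_conv_Suc by blast
    show ?thesis
      using br_unit[of "Lt (Suc i')" "Lt 0"] t unfolding i' lie_br_unit(2) by simp
  qed
  have single: "P (unit_at (Lm ({#i#}, E)))" if "0 < i" "i < m" for i
    using t_root[OF that(1)] unfolding root_def tau_unit[OF that(2)] on_module_unit .
  have I: "P (unit_at (Lm ({#}, I i)))" if "0 < m + i" for i
    using t_root[OF that] unfolding tau_root[OF le_add1] on_module_unit add_diff_cancel_left' .
  have mult: "P (unit_at (Lm (\<nu> + \<mu>, z)))"
    if "(\<mu>, z) \<in> allowed" "P (unit_at (Lm (\<mu>, z)))" "set_mset \<nu> \<subseteq> {..<m}" for \<mu> \<nu> z
    using that(3)
  proof (induction \<nu>)
    case empty
    show ?case using that(2) by simp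
  next
    case (add i \<nu>)
    have "(\<nu> + \<mu>, z) \<in> allowed"
      using that(1) add.prems by (auto simp: allowed_def module_monos_def split: slot.splits)
    moreover have "P (unit_at (Lm (\<nu> + \<mu>, z)))"
      using add by simp
    ultimately have "P (on_module (tau i (unit_at (\<nu> + \<mu>, z))))"
      by (rule t_mult)
    moreover have "i < m"
      using add.prems by simp
    ultimately show ?case
      by (simp only: tau_unit on_module_unit union_mset_add_mset_left)
  qed
  have W_allowed: "({#}, W k l) \<in> allowed \<longleftrightarrow> l \<in> S" for k l
    by (auto simp: allowed_def module_monos_def)
  have W: "P (unit_at (Lm ({#}, W k l)))" if "l \<in> S" for k l
    using that
  proof (induction l arbitrary: k rule: less_induct)
    case (less l)
    have "l \<noteq> 0"
      using less.prems S by metis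
    then have allowed: "({#}, I l) \<in> allowed"
      by (auto simp: allowed_def module_monos_def)
    let ?w = "\<lambda>l'. unit_at (Lm ({#}, W (2 * l - 2 * l') l')) :: lie_basis \<Rightarrow> 'k"
    have sum: "finite_on lie_indices (\<lambda>b. \<Sum>l'\<in>A. c l' * ?w l' b) \<and> P (\<lambda>b. \<Sum>l'\<in>A. c l' * ?w l' b)"
      if "finite A" "A \<subseteq> S \<inter> {..<l}" for A and c :: "nat \<Rightarrow> 'k"
      using that
    proof induction
      case empty
      show ?case
        using scale[of "unit_at Ls" 0] x fin[of Ls] by (simp add: finite_on_def)
    next
      case (insert a A)
      have a: "P (?w a)" "Lm ({#}, W (2 * l - 2 * a) a) \<in> lie_indices"
        using less.IH[of a] insert.prems W_allowed by auto
      have fa: "finite_on lie_indices (\<lambda>b. c a * ?w a b)"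
        using a(2) by (auto simp: finite_on_def)
      have IH: "finite_on lie_indices (\<lambda>b. \<Sum>l'\<in>A. c l' * ?w l' b)" "P (\<lambda>b. \<Sum>l'\<in>A. c l' * ?w l' b)"
        using insert by auto
      have "P (\<lambda>b. c a * ?w a b + (\<Sum>l'\<in>A. c l' * ?w l' b))"
        by (rule add[OF fa IH(1) scale[OF fin[OF a(2)] a(1)] IH(2)])
      moreover have "finite_on lie_indices (\<lambda>b. c a * ?w a b + (\<Sum>l'\<in>A. c l' * ?w l' b))"
        by (rule finite_onI[of "{b. c a * ?w a b \<noteq> 0} \<union> {b. (\<Sum>l'\<in>A. c l' * ?w l' b) \<noteq> 0}"])
          (use fa IH(1) in \<open>auto simp: finite_on_def\<close>)
      ultimately show ?case
        using insert.hyps by simp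
    qed
    let ?A = "S \<inter> {..<l}"
    define f where "f = (on_module (tau (m + l) (unit_at ({#}, I l))) :: lie_basis \<Rightarrow> 'k)"
    have f: "P f"
      unfolding f_def using \<open>l \<noteq> 0\<close> by (intro t_mult[OF allowed] I) simp
    have f_eq: "f b = 2 * unit_at (Lm ({#}, W 0 l)) b + (\<Sum>l'\<in>?A. sym_coef l l l' * ?w l' b)" for b
      unfolding f_def on_module_def tau_I_diag[OF less.prems]
      by (cases b) (auto intro!: sum.neutral)
    have rest: "finite_on lie_indices (\<lambda>b. \<Sum>l'\<in>?A. (- sym_coef l l l') * ?w l' b)"
      "P (\<lambda>b. \<Sum>l'\<in>?A. (- sym_coef l l l') * ?w l' b)"
      using sum[of ?A "\<lambda>l'. - sym_coef l l l'"] by auto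
    have fin_f: "finite_on lie_indices f"
    proof (rule finite_onI)
      let ?B = "insert (Lm ({#}, W 0 l)) ((\<lambda>l'. Lm ({#}, W (2 * l - 2 * l') l')) ` ?A)"
      show "finite ?B" by simp
      show "?B \<subseteq> lie_indices"
        using less.prems W_allowed by auto
      show "b \<in> ?B" if "f b \<noteq> 0" for b
      proof (rule ccontr)
        assume "b \<notin> ?B"
        then have "f b = 0"
          unfolding f_eq by (auto intro!: sum.neutral)
        with that show False by simp
      qed
    qed
    have fin_sum: "finite_on lie_indices (\<lambda>b. f b + (\<Sum>l'\<in>?A. (- sym_coef l l l') * ?w l' b))"
      by (rule finite_onI[of "{b. f b \<noteq> 0} \<union> {b. (\<Sum>l'\<in>?A. (- sym_coef l l l') * ?w l' b) \<noteq> 0}"])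
        (use fin_f rest(1) in \<open>auto simp: finite_on_def\<close>)
    have "P (\<lambda>b. 1 / 2 * (f b + (\<Sum>l'\<in>?A. (- sym_coef l l l') * ?w l' b)))"
      by (rule scale[OF fin_sum add[OF fin_f rest(1) f rest(2)]])
    moreover have "(\<lambda>b. 1 / 2 * (f b + (\<Sum>l'\<in>?A. (- sym_coef l l l') * ?w l' b)))
        = unit_at (Lm ({#}, W 0 l))"
    proof
      fix b
      have "f b + (\<Sum>l'\<in>?A. (- sym_coef l l l') * ?w l' b) = 2 * unit_at (Lm ({#}, W 0 l)) b"
        unfolding f_eq by (simp only: mult_minus_left sum_negf add.assoc right_minus add_0_right)
      then show "1 / 2 * (f b + (\<Sum>l'\<in>?A. (- sym_coef l l l') * ?w l' b)) = unit_at (Lm ({#}, W 0 l)) b"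
        using two by simp
    qed
    ultimately have W0: "P (unit_at (Lm ({#}, W 0 l)))"
      by simp
    show ?case
    proof (induction k)
      case (Suc k)
      have "({#}, W k l) \<in> allowed"
        using W_allowed less.prems by simp
      then show ?case
        using br_unit[of Ls "Lm ({#}, W k l)"] x Suc not_root
        by (simp add: lie_br_unit derivation_unit slot_shift_W on_module_unit)
    qed (rule W0)
  qed
  show ?thesis
  proof (cases l)
    case Ls
    then show ?thesis using x by simp
  next
    case (Lt i)
    then show ?thesis using t by simp
  next
    case (Lm x)
    obtain \<mu> z where x: "x = (\<mu>, z)" by (cases x)
    have allowed: "(\<mu>, z) \<in> allowed" "set_mset \<mu> \<subseteq> {..<m}"
      using l by (auto simp: Lm x allowed_def module_monos_def)
    show ?thesis
    proof (cases z)
      case E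
      with allowed obtain i where i: "i \<in># \<mu>" "0 < i"
        by (auto simp: allowed_def)
      then obtain \<nu> where \<nu>: "\<mu> = \<nu> + {#i#}"
        by (metis add_mset_add_single multi_member_split)
      have "({#i#}, E) \<in> allowed" "i < m"
        using i allowed by (auto simp: allowed_def module_monos_def)
      then have "P (unit_at (Lm (\<nu> + {#i#}, E)))"
        using i allowed(2) \<nu> by (intro mult single) auto
      then show ?thesis by (simp add: Lm x \<nu> E)
    next
      case (I i)
      have "({#}, I i) \<in> allowed" "0 < m + i"
        using allowed I by (auto simp: allowed_def module_monos_def)
      then have "P (unit_at (Lm (\<mu> + {#}, I i)))"
        using allowed(2) by (intro mult \<open>\<And>i. 0 < m + i \<Longrightarrow> P (unit_at (Lm ({#}, I i)))\<close>) auto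
      then show ?thesis by (simp add: Lm x I)
    next
      case (W k n)
      have "n \<in> S"
        using allowed W by (auto simp: allowed_def module_monos_def)
      then have "P (unit_at (Lm (\<mu> + {#}, W k n)))"
        using allowed(2) W_allowed \<open>\<And>l k. l \<in> S \<Longrightarrow> P (unit_at (Lm ({#}, W k l)))\<close>
        by (intro mult) auto
      then show ?thesis by (simp add: Lm x W)
    qed
  qed
qed

end

section \<open>Counting basis elements\<close>

context module_ops
begin

lemma weight_simps [simp]: "weight {#} = 0" "weight (add_mset j \<mu>) = Suc j + weight \<mu>"
  by (simp_all add: weight_def)

lemma count_le_weight: "count \<mu> j \<le> weight \<mu>"
  by (induction \<mu>) auto

lemma weight_le:
  assumes "set_mset \<mu> \<subseteq> {..<m}"
  shows "weight \<mu> \<le> m * size \<mu>"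
  using assms by (induction \<mu>) (auto simp: algebra_simps)

definition multisets_upto :: "nat \<Rightarrow> nat multiset set" where
  "multisets_upto n = {\<mu>. set_mset \<mu> \<subseteq> {..<m} \<and> (\<forall>j. count \<mu> j \<le> n)}"

lemma bij_multisets_upto:
  "bij_betw (\<lambda>\<mu>. restrict (count \<mu>) {..<m}) (multisets_upto n) ({..<m} \<rightarrow>\<^sub>E {..n})"
proof (rule bij_betw_imageI)
  show "inj_on (\<lambda>\<mu>. restrict (count \<mu>) {..<m}) (multisets_upto n)"
  proof (intro inj_onI multiset_eqI)
    fix \<mu> \<nu> j
    assume \<mu>: "\<mu> \<in> multisets_upto n" and \<nu>: "\<nu> \<in> multisets_upto n"
      and eq: "restrict (count \<mu>) {..<m} = restrict (count \<nu>) {..<m}"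
    show "count \<mu> j = count \<nu> j"
    proof (cases "j < m")
      case True
      with fun_cong[OF eq, of j] show ?thesis by simp
    next
      case False
      then have "j \<notin># \<mu>" "j \<notin># \<nu>"
        using \<mu> \<nu> by (auto simp: multisets_upto_def)
      then show ?thesis by (simp add: not_in_iff)
    qed
  qed
  show "(\<lambda>\<mu>. restrict (count \<mu>) {..<m}) ` multisets_upto n = {..<m} \<rightarrow>\<^sub>E {..n}"
  proof
    show "(\<lambda>\<mu>. restrict (count \<mu>) {..<m}) ` multisets_upto n \<subseteq> {..<m} \<rightarrow>\<^sub>E {..n}"
      by (auto simp: multisets_upto_def split: if_splits)
    show "{..<m} \<rightarrow>\<^sub>E {..n} \<subseteq> (\<lambda>\<mu>. restrict (count \<mu>) {..<m}) ` multisets_upto n"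
    proof
      fix g assume g: "g \<in> {..<m} \<rightarrow>\<^sub>E {..n}"
      define \<mu> where "\<mu> = (\<Sum>j<m. replicate_mset (g j) j)"
      have count: "count \<mu> i = (if i < m then g i else 0)" for i
      proof -
        have "count \<mu> i = (\<Sum>j<m. if j = i then g i else 0)"
          unfolding \<mu>_def count_sum by (intro sum.cong) auto
        then show ?thesis by simp
      qed
      have "\<mu> \<in> multisets_upto n"
        using g by (auto simp: multisets_upto_def count PiE_def Pi_def
            simp flip: count_greater_zero_iff split: if_splits)
      moreover have "g = restrict (count \<mu>) {..<m}"
        using g by (auto simp: fun_eq_iff count PiE_def extensional_def)
      ultimately show "g \<in> (\<lambda>\<mu>. restrict (count \<mu>) {..<m}) ` multisets_upto n"
        by blast
    qed
  qed
qed

lemma card_multisets_upto: "card (multisets_upto n) = (n + 1) ^ m"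
  using bij_betw_same_card[OF bij_multisets_upto] by (simp add: card_PiE)

lemma finite_multisets_upto: "finite (multisets_upto n)"
  using bij_betw_finite[OF bij_multisets_upto] by (simp add: finite_PiE)

lemma weight_multisets_upto:
  assumes "\<mu> \<in> multisets_upto n"
  shows "weight \<mu> \<le> m * (m * n)"
proof -
  have sub: "set_mset \<mu> \<subseteq> {..<m}"
    using assms by (simp add: multisets_upto_def)
  have "size \<mu> = (\<Sum>j\<in>set_mset \<mu>. count \<mu> j)"
    by (rule size_multiset_overloaded_eq)
  also have "\<dots> \<le> (\<Sum>j\<in>set_mset \<mu>. n)"
    using assms by (intro sum_mono) (simp add: multisets_upto_def)
  also have "\<dots> \<le> m * n"
    using card_mono[OF _ sub] by simp
  finally have "m * size \<mu> \<le> m * (m * n)"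
    by simp
  then show ?thesis
    using weight_le[OF sub] by (rule order_trans[rotated])
qed

definition slots_upto :: "nat \<Rightarrow> slot set" where
  "slots_upto n = {E} \<union> I ` {..n} \<union> (\<lambda>(k, l). W k l) ` ({..n} \<times> (S \<inter> {..n}))"

lemma lie_deg_le_subset:
  "{l \<in> lie_indices. lie_deg l \<le> n} \<subseteq>
    insert Ls (Lt ` {..<n} \<union> Lm ` (multisets_upto n \<times> slots_upto n))"
proof
  fix l assume l: "l \<in> {l \<in> lie_indices. lie_deg l \<le> n}"
  show "l \<in> insert Ls (Lt ` {..<n} \<union> Lm ` (multisets_upto n \<times> slots_upto n))"
  proof (cases l)
    case (Lm x)
    obtain \<mu> z where x: "x = (\<mu>, z)" by (cases x)
    have deg: "weight \<mu> + slot_deg z < n" and mem: "(\<mu>, z) \<in> module_monos"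
      using l by (auto simp: Lm x mono_deg_def allowed_def)
    have "\<mu> \<in> multisets_upto n"
      using mem deg order_trans[OF count_le_weight[of \<mu>], of n]
      by (simp add: multisets_upto_def module_monos_def)
    moreover have "z \<in> slots_upto n"
      using mem deg by (cases z) (auto simp: slots_upto_def module_monos_def)
    ultimately show ?thesis by (simp add: Lm x)
  qed (use l in auto)
qed

lemma card_slots_upto: "finite (slots_upto n)" "card (slots_upto n) \<le> 1 + (n + 1) + (n + 1) * card (S \<inter> {..n})"
proof -
  show "finite (slots_upto n)"
    by (simp add: slots_upto_def)
  have "card (slots_upto n) \<le> card {E} + card (I ` {..n}) + card ((\<lambda>(k, l). W k l) ` ({..n} \<times> (S \<inter> {..n})))"
    unfolding slots_upto_def by (intro order_trans[OF card_Un_le] add_mono card_Un_le order_refl)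
  also have "\<dots> \<le> 1 + (n + 1) + (n + 1) * card (S \<inter> {..n})"
    using card_image_le[of "{..n}" I] card_image_le[of "{..n} \<times> (S \<inter> {..n})" "\<lambda>(k, l). W k l"]
    by (simp add: card_cartesian_product)
  finally show "card (slots_upto n) \<le> 1 + (n + 1) + (n + 1) * card (S \<inter> {..n})" .
qed

lemma finite_lie_deg_le: "finite {l \<in> lie_indices. lie_deg l \<le> n}"
  by (rule finite_subset[OF lie_deg_le_subset]) (simp add: finite_multisets_upto card_slots_upto)

lemma card_lie_deg_le:
  "card {l \<in> lie_indices. lie_deg l \<le> n}
    \<le> 1 + n + (n + 1) ^ m * (1 + (n + 1) + (n + 1) * card (S \<inter> {..n}))"
proof -
  let ?M = "multisets_upto n \<times> slots_upto n"
  have fin: "finite ?M"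
    by (simp add: finite_multisets_upto card_slots_upto)
  have "card {l \<in> lie_indices. lie_deg l \<le> n} \<le> card (insert Ls (Lt ` {..<n} \<union> Lm ` ?M))"
    using fin by (intro card_mono lie_deg_le_subset) simp
  also have "\<dots> \<le> Suc (card (Lt ` {..<n} \<union> Lm ` ?M))"
    using fin by (simp add: card_insert_if)
  also have "\<dots> \<le> Suc (card (Lt ` {..<n}) + card (Lm ` ?M))"
    using card_Un_le by simp
  also have "\<dots> \<le> Suc (n + card ?M)"
    using card_image_le[of "{..<n}" Lt] card_image_le[OF fin, of Lm] by simp
  also have "\<dots> \<le> 1 + n + (n + 1) ^ m * (1 + (n + 1) + (n + 1) * card (S \<inter> {..n}))"
    unfolding card_cartesian_product card_multisets_upto
    using mult_le_mono2[OF card_slots_upto(2)[of n]] by simp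
  finally show ?thesis .
qed

text \<open>
  A lower bound from the monomials with slot \<open>W k l\<close> in which all exponents are at most \<open>n\<close>: the
  variables \<open>y\<^sub>j\<close> contribute at most \<open>m\<^sup>2 n\<close> to the degree, and the rest is at most \<open>2 m + 3 + 3 n\<close>.
\<close>

lemma card_lie_deg_ge:
  "(n + 1) ^ m * ((n + 1) * card (S \<inter> {..n}))
    \<le> card {l \<in> lie_indices. lie_deg l \<le> (m * m + 2 * m + 6) * (n + 1)}"
proof -
  let ?W = "(\<lambda>(k, l). W k l) ` ({..n} \<times> (S \<inter> {..n}))"
  have "Lm ` (multisets_upto n \<times> ?W) \<subseteq> {l \<in> lie_indices. lie_deg l \<le> (m * m + 2 * m + 6) * (n + 1)}"
  proof
    fix b assume "b \<in> Lm ` (multisets_upto n \<times> ?W)"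
    then obtain \<mu> k l where b: "b = Lm (\<mu>, W k l)" "\<mu> \<in> multisets_upto n" "k \<le> n" "l \<in> S" "l \<le> n"
      by auto
    have "(\<mu>, W k l) \<in> allowed"
      using b by (simp add: allowed_def module_monos_def multisets_upto_def)
    moreover have "mono_deg (\<mu>, W k l) \<le> (m * m + 2 * m + 6) * (n + 1)"
      using weight_multisets_upto[OF b(2)] b(3,5) by (simp add: mono_deg_def algebra_simps)
    ultimately show "b \<in> {l \<in> lie_indices. lie_deg l \<le> (m * m + 2 * m + 6) * (n + 1)}"
      using b(1) by simp
  qed
  then have "card (Lm ` (multisets_upto n \<times> ?W)) \<le> card {l \<in> lie_indices. lie_deg l \<le> (m * m + 2 * m + 6) * (n + 1)}"
    by (rule card_mono[OF finite_lie_deg_le])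
  moreover have "card (Lm ` (multisets_upto n \<times> ?W)) = (n + 1) ^ m * ((n + 1) * card (S \<inter> {..n}))"
    by (subst card_image) (auto simp: inj_on_def card_cartesian_product card_multisets_upto card_image)
  ultimately show ?thesis by simp
qed

end

text \<open>
  The jumps of \<open>l \<mapsto> \<lfloor>l\<^sup>\<sigma>\<rfloor>\<close>. Since consecutive values differ by at most \<open>1\<close> for \<open>\<sigma> \<le> 1\<close>, the number of
  jumps up to \<open>n\<close> is \<open>\<lfloor>n\<^sup>\<sigma>\<rfloor>\<close> (with \<open>0 powr \<sigma> = 0\<close>, also for \<open>\<sigma> = 0\<close>).
\<close>

definition sparse_set :: "real \<Rightarrow> nat set" where
  "sparse_set \<sigma> = {l. 0 < l \<and> \<lfloor>real (l - 1) powr \<sigma>\<rfloor> < \<lfloor>real l powr \<sigma>\<rfloor>}"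

text \<open>With \<open>y = n / (n + 1) \<le> 1\<close> one has \<open>y \<le> y\<^sup>\<sigma>\<close>, hence \<open>(n + 1)\<^sup>\<sigma> - (n + 1)\<^sup>\<sigma>\<^sup>-\<^sup>1 \<le> n\<^sup>\<sigma>\<close>.\<close>

lemma powr_Suc_le:
  assumes "0 \<le> \<sigma>" "\<sigma> \<le> 1"
  shows "real (Suc n) powr \<sigma> \<le> real n powr \<sigma> + 1"
proof (cases "n = 0")
  case False
  let ?x = "real (Suc n)" and ?y = "real n / real (Suc n)"
  have "?x powr \<sigma> * ?y \<le> ?x powr \<sigma> * ?y powr \<sigma>"
    using powr_mono'[OF assms(2), of ?y] False by (intro mult_left_mono) auto
  also have "\<dots> = real n powr \<sigma>"
    by (subst powr_mult[symmetric]) auto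
  finally have "?x powr \<sigma> * ?y \<le> real n powr \<sigma>" .
  moreover have "?x powr \<sigma> * ?y = ?x powr \<sigma> - ?x powr \<sigma> / ?x"
    by (simp add: field_simps)
  moreover have "?x powr \<sigma> \<le> ?x powr 1"
    using assms(2) by (intro powr_mono) auto
  then have "?x powr \<sigma> / ?x \<le> 1"
    by simp
  ultimately show ?thesis
    by linarith
qed simp

lemma card_sparse_set:
  assumes "0 \<le> \<sigma>" "\<sigma> \<le> 1"
  shows "int (card (sparse_set \<sigma> \<inter> {..n})) = \<lfloor>real n powr \<sigma>\<rfloor>"
proof (induction n)
  case 0
  have "sparse_set \<sigma> \<inter> {..0} = {}"
    by (auto simp: sparse_set_def)
  then show ?case by simp
next
  case (Suc n)
  have mono: "\<lfloor>real n powr \<sigma>\<rfloor> \<le> \<lfloor>real (Suc n) powr \<sigma>\<rfloor>"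
    using assms(1) by (intro floor_mono powr_mono2) auto
  have "\<lfloor>real (Suc n) powr \<sigma>\<rfloor> \<le> \<lfloor>real n powr \<sigma> + 1\<rfloor>"
    using powr_Suc_le[OF assms] by (rule floor_mono)
  then have step: "\<lfloor>real (Suc n) powr \<sigma>\<rfloor> \<le> \<lfloor>real n powr \<sigma>\<rfloor> + 1"
    by simp
  show ?case
  proof (cases "Suc n \<in> sparse_set \<sigma>")
    case True
    then have "sparse_set \<sigma> \<inter> {..Suc n} = insert (Suc n) (sparse_set \<sigma> \<inter> {..n})"
      by auto
    moreover have "\<lfloor>real n powr \<sigma>\<rfloor> < \<lfloor>real (Suc n) powr \<sigma>\<rfloor>"
      using True by (simp add: sparse_set_def)
    ultimately show ?thesis
      using Suc step by simp
  next
    case False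
    then have "sparse_set \<sigma> \<inter> {..Suc n} = sparse_set \<sigma> \<inter> {..n}"
      by (auto simp: le_Suc_eq)
    moreover have "\<not> \<lfloor>real n powr \<sigma>\<rfloor> < \<lfloor>real (Suc n) powr \<sigma>\<rfloor>"
      using False by (simp add: sparse_set_def)
    ultimately show ?thesis
      using Suc mono by simp
  qed
qed

lemma card_sparse_set_bounds:
  assumes "0 \<le> \<sigma>" "\<sigma> \<le> 1"
  shows "real (card (sparse_set \<sigma> \<inter> {..n})) \<le> real n powr \<sigma>"
    and "1 \<le> n \<Longrightarrow> real n powr \<sigma> / 2 \<le> real (card (sparse_set \<sigma> \<inter> {..n}))"
proof -
  have eq: "real (card (sparse_set \<sigma> \<inter> {..n})) = of_int \<lfloor>real n powr \<sigma>\<rfloor>"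
    using card_sparse_set[OF assms, of n] by (metis of_int_of_nat_eq)
  show "real (card (sparse_set \<sigma> \<inter> {..n})) \<le> real n powr \<sigma>"
    unfolding eq by (rule of_int_floor_le)
  show "real n powr \<sigma> / 2 \<le> real (card (sparse_set \<sigma> \<inter> {..n}))" if "1 \<le> n"
  proof -
    have "1 \<le> real n powr \<sigma>"
      using that assms(1) by (simp add: ge_one_powr_ge_zero)
    then have "1 \<le> \<lfloor>real n powr \<sigma>\<rfloor>"
      by simp
    then have "1 \<le> real_of_int \<lfloor>real n powr \<sigma>\<rfloor>"
      by linarith
    moreover have "real n powr \<sigma> < of_int \<lfloor>real n powr \<sigma>\<rfloor> + 1"
      by linarith
    ultimately show ?thesis
      unfolding eq by linarith
  qed
qed

lemma lie_growth_upper: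
  assumes "0 \<le> \<sigma>" "\<sigma> \<le> 1" "1 \<le> n"
  shows "card {l \<in> module_ops.lie_indices m (sparse_set \<sigma>). module_ops.lie_deg m l \<le> n}
    \<le> (2 + 2 ^ m * 5) * real n powr (real m + 1 + \<sigma>)"
proof -
  interpret module_ops m "sparse_set \<sigma>" .
  let ?r = "real m + 1 + \<sigma>" and ?s = "real (card (sparse_set \<sigma> \<inter> {..n}))"
  have n: "1 \<le> real n" using assms(3) by simp
  have pow0: "real n powr 0 \<le> real n powr ?r" and pow1: "real n powr 1 \<le> real n powr ?r"
    and pow_m: "real n powr (real m + 1) \<le> real n powr ?r"
    using n assms(1) by - (rule powr_mono; simp)+
  have n1: "real n + 1 \<le> 2 * real n"
    using n by simp
  have "real (card {l \<in> lie_indices. lie_deg l \<le> n})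
      \<le> real (1 + n + (n + 1) ^ m * (1 + (n + 1) + (n + 1) * card (sparse_set \<sigma> \<inter> {..n})))"
    using card_lie_deg_le by (simp only: of_nat_le_iff)
  also have "\<dots> = 1 + real n + (real n + 1) ^ m * (2 + real n + (real n + 1) * ?s)"
    by (simp add: algebra_simps)
  also have "\<dots> \<le> 1 + real n + (2 * real n) ^ m * (3 * real n + 2 * real n * real n powr \<sigma>)"
    using n n1 card_sparse_set_bounds(1)[OF assms(1,2), of n]
    by (intro add_mono order_refl mult_mono power_mono) auto
  also have "\<dots> = real n powr 0 + real n powr 1
      + 2 ^ m * (3 * real n powr (real m + 1) + 2 * real n powr ?r)"
    using n by (simp add: powr_add powr_realpow power_mult_distrib algebra_simps)
  also have "\<dots> \<le> real n powr ?r + real n powr ?r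
      + 2 ^ m * (3 * real n powr ?r + 2 * real n powr ?r)"
    by (intro add_mono mult_left_mono order_refl pow0 pow1 pow_m) auto
  also have "\<dots> = (2 + 2 ^ m * 5) * real n powr ?r"
    by (simp add: algebra_simps)
  finally show ?thesis .
qed

lemma lie_growth_lower:
  assumes "0 \<le> \<sigma>" "\<sigma> \<le> 1"
  shows "\<exists>c>0. \<forall>n\<ge>1. c * real n powr (real m + 1 + \<sigma>)
    \<le> card {l \<in> module_ops.lie_indices m (sparse_set \<sigma>). module_ops.lie_deg m l \<le> n}"
proof -
  interpret module_ops m "sparse_set \<sigma>" .
  let ?r = "real m + 1 + \<sigma>"
  define D where "D = m * m + 2 * m + 6"
  have D: "D > 0" by (simp add: D_def)
  define c where "c = (1 / (4 * real D)) powr ?r / 2"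
  have "c * real n powr ?r \<le> card {l \<in> lie_indices. lie_deg l \<le> n}" if n: "n \<ge> 1" for n
  proof -
    have c_eq: "c * real n powr ?r = (real n / (4 * real D)) powr ?r / 2"
      by (simp add: c_def powr_mult[symmetric])
    show ?thesis
    \<comment> \<open>Monomials with exponents at most \<open>N\<close> have degree at most \<open>D (N + 1)\<close>, so \<open>N + 1 = n div D\<close> is
      the right choice. For small \<open>n\<close> the single element \<open>Ls\<close> is enough, since \<open>c n\<^sup>r \<le> 1 / 2\<close> then.\<close>
    proof (cases "n < 4 * D")
      case True
      then have "(real n / (4 * real D)) powr ?r \<le> 1 powr ?r"
        using assms D by (intro powr_mono2) auto
      moreover have "card {Ls} \<le> card {l \<in> lie_indices. lie_deg l \<le> n}"
        using n by (intro card_mono finite_lie_deg_le) auto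
      ultimately show ?thesis
        unfolding c_eq by simp
    next
      case False
      define N where "N = n div D - 1"
      have "4 \<le> n div D"
        using False D by (simp add: less_eq_div_iff_mult_less_eq)
      then have N: "N + 1 = n div D" "N \<ge> 1"
        by (simp_all add: N_def)
      have "n < D * (n div D) + D"
        using D by (metis mult_div_mod_eq mod_less_divisor nat_add_left_cancel_less)
      also have "\<dots> = D * (N + 2)"
        unfolding N(1)[symmetric] by simp
      also have "\<dots> \<le> D * (4 * N)"
        using N(2) by (intro mult_le_mono2) simp
      finally have "real n < real (D * (4 * N))"
        by (simp only: of_nat_less_iff)
      then have le: "real n / (4 * real D) \<le> real N"
        using D by (simp add: field_simps)
      have "(real n / (4 * real D)) powr ?r / 2 \<le> real N powr ?r / 2"
        using le assms by (intro divide_right_mono powr_mono2) auto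
      also have "\<dots> = real N ^ m * (real N * (real N powr \<sigma> / 2))"
        using N by (simp add: powr_add powr_realpow)
      also have "\<dots> \<le> real (N + 1) ^ m * (real (N + 1) * real (card (sparse_set \<sigma> \<inter> {..N})))"
        using card_sparse_set_bounds(2)[OF assms N(2)] by (intro mult_mono power_mono) auto
      also have "\<dots> = real ((N + 1) ^ m * ((N + 1) * card (sparse_set \<sigma> \<inter> {..N})))"
        by (simp add: algebra_simps)
      also have "\<dots> \<le> real (card {l \<in> lie_indices. lie_deg l \<le> D * (N + 1)})"
        using card_lie_deg_ge[of N] by (simp only: of_nat_le_iff D_def)
      also have "\<dots> \<le> real (card {l \<in> lie_indices. lie_deg l \<le> n})"
        using N(1) by (intro of_nat_mono card_mono finite_lie_deg_le)
          (auto intro: order_trans[OF _ div_times_less_eq_dividend[of n D, unfolded mult.commute[of _ D]]])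
      finally show ?thesis
        unfolding c_eq .
    qed
  qed
  moreover have "c > 0"
    using D by (simp add: c_def)
  ultimately show ?thesis by blast
qed

lemma two_neq_zero:
  assumes "CHAR('k::field) \<noteq> 2"
  shows "(2 :: 'k) \<noteq> 0"
proof
  assume "(2 :: 'k) = 0"
  then have "CHAR('k) dvd 2"
    by (metis of_nat_eq_0_iff_char_dvd of_nat_numeral)
  then have "CHAR('k) = 1 \<or> CHAR('k) = 2"
    by (metis prime_nat_iff two_is_prime_nat)
  then show False
    using assms CHAR_not_1[where ?'a = 'k] by simp
qed

lemma (in module_ops) graded_lie_algebra_lie_br:
  assumes two: "(2 :: 'k::field) \<noteq> 0" and S: "0 \<notin> S"
  shows "graded_lie_algebra lie_indices lie_deg (lie_br :: (lie_basis \<Rightarrow> 'k) \<Rightarrow> _) Ls (Lt 0)"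
proof
  have mem: "l \<in> lie_indices" if "finite_on lie_indices f" "f l \<noteq> 0" for f :: "lie_basis \<Rightarrow> 'k" and l
    using that by (rule finite_on_mem)
  show "infinite lie_indices"
  proof
    assume "finite lie_indices"
    then have "finite (range Lt)"
      by (rule rev_finite_subset) auto
    then show False
      by (simp add: finite_image_iff inj_on_def)
  qed
  show "finite {l \<in> lie_indices. lie_deg l = n}" for n
    by (rule finite_subset[OF _ finite_lie_deg_le[of n]]) auto
  show "0 < lie_deg l" if "l \<in> lie_indices" for l
    by (cases l) (simp_all add: mono_deg_def)
  show "lie_br (\<lambda>l. f l + f' l) g = (\<lambda>l. lie_br f g l + lie_br f' g l)" for f f' g :: "lie_basis \<Rightarrow> 'k"
    by (rule lie_br_add)
  show "lie_br (\<lambda>l. c * f l) g = (\<lambda>l. c * lie_br f g l)" for c and f g :: "lie_basis \<Rightarrow> 'k"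
    by (rule lie_br_scale)
  show "lie_br f g l = - lie_br g f l" for l and f g :: "lie_basis \<Rightarrow> 'k"
    by (rule lie_br_antisym)
  show "l \<in> lie_indices \<and> (\<exists>l1 l2. f l1 \<noteq> 0 \<and> g l2 \<noteq> 0 \<and> lie_deg l = lie_deg l1 + lie_deg l2)"
    if "finite_on lie_indices f" "finite_on lie_indices g" "lie_br f g l \<noteq> 0"
    for l and f g :: "lie_basis \<Rightarrow> 'k"
    using mem[OF that(1)] mem[OF that(2)] that(3) by (rule lie_br_graded)
  show "lie_br (lie_br f g) h l + lie_br (lie_br g h) f l + lie_br (lie_br h f) g l = 0"
    if fgh: "finite_on lie_indices f" "finite_on lie_indices g" "finite_on lie_indices h"
    for l and f g h :: "lie_basis \<Rightarrow> 'k"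
  proof -
    have bound: "\<exists>N. \<forall>i\<ge>N. f (Lt i) = 0" if "finite_on lie_indices f" for f :: "lie_basis \<Rightarrow> 'k"
    proof -
      have "finite (Lt -` {l. f l \<noteq> 0})"
        using that by (intro finite_vimageI) (simp_all add: finite_on_def inj_def)
      then obtain N where N: "\<forall>i\<in>Lt -` {l. f l \<noteq> 0}. i < N"
        using finite_nat_set_iff_bounded by blast
      then have "\<forall>i\<ge>N. f (Lt i) = 0"
        by force
      then show ?thesis ..
    qed
    obtain N1 N2 N3 where N: "\<forall>i\<ge>N1. f (Lt i) = 0" "\<forall>i\<ge>N2. g (Lt i) = 0" "\<forall>i\<ge>N3. h (Lt i) = 0"
      using bound[OF fgh(1)] bound[OF fgh(2)] bound[OF fgh(3)] by blast
    show ?thesis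
      by (rule lie_br_jacobi[of "max N1 (max N2 N3)"]) (use N in auto)
  qed
  show "lie_br (unit_at Ls) (unit_at (Lt 0)) \<noteq> (\<lambda>_. 0 :: 'k)"
    unfolding lie_br_unit(1) by (auto simp: fun_eq_iff)
  show "P (unit_at l)"
    if "l \<in> lie_indices" "P (unit_at Ls)" "P (unit_at (Lt 0))"
      "\<And>f g. finite_on lie_indices f \<Longrightarrow> finite_on lie_indices g \<Longrightarrow> P f \<Longrightarrow> P g \<Longrightarrow> P (\<lambda>l. f l + g l)"
      "\<And>f c. finite_on lie_indices f \<Longrightarrow> P f \<Longrightarrow> P (\<lambda>l. c * f l)"
      "\<And>f g. finite_on lie_indices f \<Longrightarrow> finite_on lie_indices g \<Longrightarrow> P f \<Longrightarrow> P g \<Longrightarrow> P (lie_br f g)"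
    for l and P :: "(lie_basis \<Rightarrow> 'k) \<Rightarrow> bool"
    by (rule lie_generated[OF two S that])
qed simp_all

theorem theorem3p3:
  fixes r :: real
  assumes "CHAR('k::field) \<noteq> 2"
    and "r \<ge> 1"
  shows "\<exists>(scale :: 'k \<Rightarrow> (nat \<Rightarrow>\<^sub>0 'k) \<Rightarrow> (nat \<Rightarrow>\<^sub>0 'k)) mult one part X.
    jordan_superalgebra scale mult one part \<and>
    card X = 3 \<and> unital_algebra.generates scale mult one X \<and>
    (\<forall>Y. finite Y \<and> unital_algebra.generates scale mult one Y \<longrightarrow>
       unital_algebra.upper_GKdim scale mult one Y = ereal r \<and>
       unital_algebra.lower_GKdim scale mult one Y = ereal r) \<and>
    unital_algebra.graded_by_degree scale mult one X \<and>
    (\<forall>n\<ge>1. unital_algebra.deg_component scale mult one X (3 * n) = {0}) \<and>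
    unital_algebra.solvable_of_length scale mult 3
      (unital_algebra.ideal_without_unit scale mult one X)"
proof -
  define m where "m = nat \<lfloor>r\<rfloor> - 1"
  define \<sigma> where "\<sigma> = r - of_int \<lfloor>r\<rfloor>"
  have "1 \<le> \<lfloor>r\<rfloor>"
    using assms(2) by simp
  moreover have "int (nat z - 1) = z - 1" if "1 \<le> z" for z
    using that by simp
  ultimately have "int m = \<lfloor>r\<rfloor> - 1"
    unfolding m_def by blast
  then have "real m = of_int \<lfloor>r\<rfloor> - 1"
    by (metis of_int_1 of_int_diff of_int_of_nat_eq)
  then have r: "real m + 1 + \<sigma> = r"
    using \<open>real m = of_int \<lfloor>r\<rfloor> - 1\<close> by (simp add: \<sigma>_def)
  have \<sigma>: "0 \<le> \<sigma>" "\<sigma> \<le> 1"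
    unfolding \<sigma>_def by linarith+
  interpret module_ops m "sparse_set \<sigma>" .
  have "0 \<notin> sparse_set \<sigma>"
    by (simp add: sparse_set_def)
  then interpret graded_lie_algebra lie_indices lie_deg "lie_br :: (lie_basis \<Rightarrow> 'k) \<Rightarrow> _" Ls "Lt 0"
    by (rule graded_lie_algebra_lie_br[OF two_neq_zero[OF assms(1)]])
  obtain c where c: "c > 0" "\<And>n. n \<ge> 1 \<Longrightarrow> c * real n powr r \<le> card {l \<in> lie_indices. lie_deg l \<le> n}"
    using lie_growth_lower[OF \<sigma>, of m] unfolding r by blast
  have upper: "card {l \<in> lie_indices. lie_deg l \<le> n} \<le> (2 + 2 ^ m * 5) * real n powr r" if "n \<ge> 1" for n
    using lie_growth_upper[OF \<sigma> that, of m] unfolding r .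
  show ?thesis
    by (rule jordan_double[OF c(1) _ c(2) upper]) (use assms(2) in auto)
qed

end
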